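(* Let $H$ and $F$ be graphs with $\chi(H)<\chi(F)$ such that $H$ is weakly $F$-Turán-stable and $F$ has a color-critical edge. Then for every sufficiently large $n$ there is a complete $(\chi(F)-1)$-partite graph $T$ on $n$ vertices such that $$\mathrm{rb}(n,H,F)=\mathrm{ex}(n,H,F)=\mathrm{ex}^{\mathrm{col}}(n,H,K_2;F)=\mathcal{N}(H,T).$$
   Context: All graphs are finite and simple. A copy of $H$ in a graph $G$ is a (not necessarily induced) subgraph of $G$ isomorphic to $H$. $\mathcal{N}(H,G)$ denotes the number of copies of $H$ in $G$. $\mathrm{ex}(n,H,F)$ is the largest value of $\mathcal{N}(H,G)$ over $n$-vertex $F$-free graphs $G$ (graphs containing no copy of $F$). A red-blue graph is a graph $G$ each of whose edges is colored red or blue; $G_{red}$ and $G_{blue}$ denote the subgraphs formed by the red edges and by the blue edges, respectively. $\mathcal{N}^{\mathrm{col}}(H_1,H_2;G)=\mathcal{N}(H_1,G_{red})+\mathcal{N}(H_2,G_{blue})$, and $\mathrm{ex}^{\mathrm{col}}(n,H_1,H_2;F)$ is the largest value of $\mathcal{N}^{\mathrm{col}}(H_1,H_2;G)$ over $n$-vertex red-blue graphs $G$ that are $F$-free (as uncolored graphs). Given a graph $G$ and a family $\mathcal{H}$ of subgraphs of $G$, a subgraph $F$ of $G$ is called rainbow if there is an injection $\phi:E(F)\to\mathcal{H}$ such that each edge $e\in E(F)$ is an edge of $\phi(e)$. $\mathrm{rb}(n,H,F)$ denotes the largest cardinality of a family $\mathcal{H}$ of distinct copies of $H$ in an $n$-vertex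 graph $G$ such that no copy of $F$ in $G$ is rainbow (the maximum is over all $n$-vertex graphs $G$ and all such families). The edit distance of two graphs $G,G'$ on the same vertex set is the smallest number of edges one must add to and delete from $G$ to obtain $G'$. For graphs $H,F$ with $\chi(H)<\chi(F)$, $H$ is weakly $F$-Turán-stable if every $n$-vertex $F$-free graph $G$ with $\mathcal{N}(H,G)\ge \mathrm{ex}(n,H,F)-o(n^{|V(H)|})$ has edit distance $o(n^2)$ from some complete $(\chi(F)-1)$-partite graph on the same vertex set; that is, for every $\varepsilon>0$ there are $\delta>0$ and $n_0$ such that every $F$-free graph $G$ on $n\ge n_0$ vertices with $\mathcal{N}(H,G)\ge \mathrm{ex}(n,H,F)-\delta n^{|V(H)|}$ has edit distance at most $\varepsilon n^2$ from some complete $(\chi(F)-1)$-partite graph. An edge of $F$ is color-critical if deleting it decreases the chromatic number of $F$. *)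

theory Defs
  imports Complex_Main "HOL-Library.Disjoint_Sets"
begin

text \<open>
  A graph is a pair of a vertex set and a set of edges, each edge being the two-element set of
  its endpoints. The host graphs \<open>G\<close> in the extremal functions have vertices of type \<open>nat\<close>, which
  loses nothing: every finite graph is isomorphic to such a graph.
\<close>

type_synonym 'a ugraph = "'a set \<times> 'a set set"

abbreviation verts :: "'a ugraph \<Rightarrow> 'a set" where
  "verts G \<equiv> fst G"

abbreviation edges :: "'a ugraph \<Rightarrow> 'a set set" where
  "edges G \<equiv> snd G"

definition finite_simple_graph :: "'a ugraph \<Rightarrow> bool" where
  "finite_simple_graph G \<longleftrightarrow>
     finite (verts G) \<and> (\<forall>e\<in>edges G. e \<subseteq> verts G \<and> card e = 2)"

definition nvertex_graph :: "nat \<Rightarrow> 'a ugraph \<Rightarrow> bool" where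
  "nvertex_graph n G \<longleftrightarrow> finite_simple_graph G \<and> card (verts G) = n"

definition complete_graph :: "nat \<Rightarrow> nat ugraph" where
  "complete_graph k = ({..<k}, {e. e \<subseteq> {..<k} \<and> card e = 2})"

definition subgraph :: "'a ugraph \<Rightarrow> 'a ugraph \<Rightarrow> bool" where
  "subgraph H G \<longleftrightarrow> finite_simple_graph H \<and> verts H \<subseteq> verts G \<and> edges H \<subseteq> edges G"

definition isomorphic :: "'a ugraph \<Rightarrow> 'b ugraph \<Rightarrow> bool" where
  "isomorphic G G' \<longleftrightarrow>
     (\<exists>f. bij_betw f (verts G) (verts G') \<and> edges G' = (\<lambda>e. f ` e) ` edges G)"

definition copies :: "'a ugraph \<Rightarrow> 'b ugraph \<Rightarrow> 'b ugraph set" where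
  "copies H G = {H'. subgraph H' G \<and> isomorphic H H'}"

definition num_copies :: "'a ugraph \<Rightarrow> 'b ugraph \<Rightarrow> nat" where
  "num_copies H G = card (copies H G)"

definition free_of :: "'a ugraph \<Rightarrow> 'b ugraph \<Rightarrow> bool" where
  "free_of F G \<longleftrightarrow> copies F G = {}"

definition colorable :: "nat \<Rightarrow> 'a ugraph \<Rightarrow> bool" where
  "colorable k G \<longleftrightarrow>
     (\<exists>c :: 'a \<Rightarrow> nat. c ` verts G \<subseteq> {..<k} \<and> (\<forall>u v. {u, v} \<in> edges G \<longrightarrow> c u \<noteq> c v))"

definition chromatic_number :: "'a ugraph \<Rightarrow> nat" where
  "chromatic_number G = (LEAST k. colorable k G)"

definition color_critical_edge :: "'a ugraph \<Rightarrow> 'a set \<Rightarrow> bool" where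
  "color_critical_edge F e \<longleftrightarrow>
     e \<in> edges F \<and> chromatic_number (verts F, edges F - {e}) < chromatic_number F"

text \<open>
  The \<open>k\<close> parts of a complete \<open>k\<close>-partite graph are required to be nonempty
  (this is part of \<open>partition_on\<close>).
\<close>

definition complete_multipartite :: "nat \<Rightarrow> 'a ugraph \<Rightarrow> bool" where
  "complete_multipartite k T \<longleftrightarrow> finite_simple_graph T \<and>
     (\<exists>P. partition_on (verts T) P \<and> card P = k \<and>
        edges T = {{u, v} | u v. \<exists>A\<in>P. \<exists>B\<in>P. A \<noteq> B \<and> u \<in> A \<and> v \<in> B})"

text \<open>
  In each maximum below, the set of values is finite, since a graph on \<open>n\<close> vertices has a number
  of subgraphs bounded in terms of \<open>n\<close>. It is nonempty for every \<open>F\<close> with at least one edge, as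
  witnessed by the edgeless graph.
\<close>

definition ex :: "nat \<Rightarrow> 'a ugraph \<Rightarrow> 'b ugraph \<Rightarrow> nat" where
  "ex n H F = Max {num_copies H G | G :: nat ugraph. nvertex_graph n G \<and> free_of F G}"

datatype color = Red | Blue

text \<open>
  The red and the blue subgraph are spanning: they keep all vertices of \<open>G\<close>, which matters
  when \<open>H\<^sub>1\<close> or \<open>H\<^sub>2\<close> has isolated vertices. The values of a colouring outside the edges of \<open>G\<close>
  are irrelevant.
\<close>

definition color_subgraph :: "color \<Rightarrow> ('a set \<Rightarrow> color) \<Rightarrow> 'a ugraph \<Rightarrow> 'a ugraph" where
  "color_subgraph x c G = (verts G, {e \<in> edges G. c e = x})"

definition num_copies_col ::
    "'a ugraph \<Rightarrow> 'b ugraph \<Rightarrow> 'c ugraph \<Rightarrow> ('c set \<Rightarrow> color) \<Rightarrow> nat" where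
  "num_copies_col H\<^sub>1 H\<^sub>2 G c =
     num_copies H\<^sub>1 (color_subgraph Red c G) + num_copies H\<^sub>2 (color_subgraph Blue c G)"

definition ex_col :: "nat \<Rightarrow> 'a ugraph \<Rightarrow> 'b ugraph \<Rightarrow> 'c ugraph \<Rightarrow> nat" where
  "ex_col n H\<^sub>1 H\<^sub>2 F =
     Max {num_copies_col H\<^sub>1 H\<^sub>2 G c | (G :: nat ugraph) c. nvertex_graph n G \<and> free_of F G}"

definition rainbow :: "'a ugraph set \<Rightarrow> 'a ugraph \<Rightarrow> bool" where
  "rainbow \<H> F \<longleftrightarrow>
     (\<exists>\<phi>. inj_on \<phi> (edges F) \<and> \<phi> ` edges F \<subseteq> \<H> \<and> (\<forall>e\<in>edges F. e \<in> edges (\<phi> e)))"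

definition rb :: "nat \<Rightarrow> 'a ugraph \<Rightarrow> 'b ugraph \<Rightarrow> nat" where
  "rb n H F =
     Max {card \<H> | (G :: nat ugraph) \<H>.
            nvertex_graph n G \<and> \<H> \<subseteq> copies H G \<and> (\<forall>F'\<in>copies F G. \<not> rainbow \<H> F')}"

text \<open>
  Number of edges to be deleted (\<open>D\<close>) and added (\<open>A\<close>) to turn \<open>G\<close> into \<open>G'\<close>;
  meaningful only for graphs on the same vertex set.
\<close>

definition edit_distance :: "'a ugraph \<Rightarrow> 'a ugraph \<Rightarrow> nat" where
  "edit_distance G G' =
     (LEAST m. \<exists>D A. finite D \<and> finite A \<and> edges G' = (edges G - D) \<union> A \<and> m = card D + card A)"

text \<open>\<open>weakly_Turan_stable F H\<close>: the graph \<open>H\<close> is weakly \<open>F\<close>-Turan-stable.\<close>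

definition weakly_Turan_stable :: "'b ugraph \<Rightarrow> 'a ugraph \<Rightarrow> bool" where
  "weakly_Turan_stable F H \<longleftrightarrow>
     (\<forall>\<epsilon>>0::real. \<exists>\<delta>>0::real. \<exists>n\<^sub>0::nat. \<forall>n\<ge>n\<^sub>0. \<forall>G :: nat ugraph.
        nvertex_graph n G \<and> free_of F G \<and>
        real (num_copies H G) \<ge> real (ex n H F) - \<delta> * real n ^ card (verts H) \<longrightarrow>
        (\<exists>T. complete_multipartite (chromatic_number F - 1) T \<and> verts T = verts G \<and>
             real (edit_distance G T) \<le> \<epsilon> * real n ^ 2))"

end

theory Submission
  imports Defs
begin

text \<open>
  Write \<open>k = \<chi>(F) - 1\<close> and \<open>h = |V(H)|\<close>. The chain \<open>ex \<le> rb \<le> ex_col\<close> holds in general: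
  for the second inequality one takes a maximum matching between the members of a rainbow-free family
  and the edges they contain; the matched edges form an \<open>F\<close>-free graph, coloured red or blue
  according to a minimum vertex cover.

  It remains to bound a coloured extremal graph \<open>G\<close> by some complete \<open>k\<close>-partite graph. By stability
  \<open>G\<close> is close to a complete \<open>k\<close>-partite graph, and stability also forces \<open>H\<close> to have an edge and all
  parts to have linear size. Choose the partition minimising \<open>L |I| + |M|\<close>, where \<open>I\<close> is the set of
  edges of \<open>G\<close> inside parts, \<open>M\<close> the set of missing cross pairs and \<open>L\<close> a large constant. Then a
  vertex with linearly many neighbours in its own part has linearly many in every part, which yields
  \<open>F\<close> through its critical edge; likewise every edge inside a part has an endpoint incident to
  linearly many missing pairs. Hence \<open>|I| \<le> \<beta> |M|\<close> for any prescribed \<open>\<beta> > 0\<close>. Since a missing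
  or blue cross pair costs at least \<open>\<kappa> n^(h - 2)\<close> copies of \<open>H\<close>, replacing \<open>G\<close> by the complete
  \<open>k\<close>-partite graph loses nothing.
\<close>

section \<open>Embeddings, copies and colourings\<close>

text \<open>Stability controls \<open>G\<close> only up to a small multiple of n^2 edges, while the
  conclusion is exact. The gap is closed by comparing linear costs: an inner edge brings at most h^2
  n^(h-2) copies, a missing or blue cross pair destroys at least \<kappa> n^(h-2), and \<kappa> may
  be far smaller than h^2. Hence the ratio \<beta> has to be arbitrarily small, not merely bounded.
  The constants depend on each other in this order: the part size \<delta>, then \<kappa>, \<beta>,
  the weight \<open>L\<close>, and last the precision asked of stability. The weight has one task:
  moving a vertex creates at most n missing pairs, which must be small against \<open>L\<close>
  times a linear number of inner edges. Two cases lie outside this scheme. If \<chi>(F) = 2,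
  deleting the critical edge leaves no edge, so \<open>F\<close> is one edge with isolated vertices
  and large \<open>F\<close>-free graphs are edgeless. If h = 2, a blue edge earns exactly the copy
  that it destroys, so all edges may be recoloured red.\<close>

definition image_graph :: "('a \<Rightarrow> 'b) \<Rightarrow> 'a ugraph \<Rightarrow> 'b ugraph" where
  "image_graph f G = (f ` verts G, (\<lambda>e. f ` e) ` edges G)"

text \<open>The maps are extensional, so there are finitely many and they can be counted inside a
  \<open>PiE\<close> product.\<close>

definition embeddings :: "'a ugraph \<Rightarrow> 'b ugraph \<Rightarrow> ('a \<Rightarrow> 'b) set" where
  "embeddings H G =
     {f \<in> verts H \<rightarrow>\<^sub>E verts G. inj_on f (verts H) \<and> (\<forall>e\<in>edges H. f ` e \<in> edges G)}"

lemma finite_edges: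
  assumes "finite_simple_graph G" shows "finite (edges G)"
proof (rule finite_subset)
  show "edges G \<subseteq> Pow (verts G)" using assms by (auto simp: finite_simple_graph_def)
  show "finite (Pow (verts G))" using assms by (auto simp: finite_simple_graph_def)
qed

lemma edgeE:
  assumes "finite_simple_graph G" "e \<in> edges G"
  obtains u v where "e = {u, v}" "u \<noteq> v" "u \<in> verts G" "v \<in> verts G"
proof -
  have "card e = 2" "e \<subseteq> verts G" using assms by (auto simp: finite_simple_graph_def)
  then obtain u v where "e = {u, v}" "u \<noteq> v" by (meson card_2_iff)
  then show ?thesis using that \<open>e \<subseteq> verts G\<close> by auto
qed

lemma edge_doubletonD:
  assumes "finite_simple_graph G" "{u, v} \<in> edges G"
  shows "u \<noteq> v" "u \<in> verts G" "v \<in> verts G"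
  using edgeE[OF assms] by (metis doubleton_eq_iff)+

lemma finite_simple_image_graph:
  assumes "finite_simple_graph H" "inj_on f (verts H)"
  shows "finite_simple_graph (image_graph f H)"
  using assms unfolding finite_simple_graph_def image_graph_def
  by (auto simp: card_image inj_on_subset)

text \<open>Different embeddings may have the same image. Upper bounds on copies follow from
  counting embeddings; lower bounds lose a factor, see
  \<open>card_embeddings_le_copies\<close>.\<close>

lemma copies_eq_image:
  assumes H: "finite_simple_graph H"
  shows "copies H G = (\<lambda>f. image_graph f H) ` embeddings H G"
proof (intro equalityI subsetI)
  fix H' assume "H' \<in> copies H G"
  then have sub: "subgraph H' G" and "isomorphic H H'" by (auto simp: copies_def)
  then obtain f where f: "bij_betw f (verts H) (verts H')"
      "edges H' = (\<lambda>e. f ` e) ` edges H" by (auto simp: isomorphic_def)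
  let ?f = "restrict f (verts H)"
  have e: "?f ` e = f ` e" if "e \<in> edges H" for e
  proof -
    have "e \<subseteq> verts H" using H that by (auto simp: finite_simple_graph_def)
    then show ?thesis by (intro image_cong) auto
  qed
  have "image_graph ?f H = H'"
    using f e by (auto simp: image_graph_def bij_betw_def prod_eq_iff intro!: image_eqI)
  moreover have "?f \<in> embeddings H G"
    using f e sub by (auto simp: embeddings_def subgraph_def bij_betw_def inj_on_def)
  ultimately show "H' \<in> (\<lambda>f. image_graph f H) ` embeddings H G" by blast
next
  fix H' assume "H' \<in> (\<lambda>f. image_graph f H) ` embeddings H G"
  then obtain f where f: "f \<in> embeddings H G" "H' = image_graph f H" by blast
  then show "H' \<in> copies H G"
    using finite_simple_image_graph[OF H, of f]
    by (auto simp: copies_def subgraph_def isomorphic_def embeddings_def image_graph_def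
        bij_betw_def intro!: exI[of _ f])
qed

lemma free_of_iff:
  assumes "finite_simple_graph F"
  shows "free_of F G \<longleftrightarrow> embeddings F G = {}"
  unfolding free_of_def copies_eq_image[OF assms] by simp

lemma finite_embeddings:
  assumes "finite (verts H)" "finite (verts G)" shows "finite (embeddings H G)"
  by (rule finite_subset[of _ "verts H \<rightarrow>\<^sub>E verts G"])
    (use assms in \<open>auto simp: embeddings_def intro: finite_PiE\<close>)

lemma finite_copies:
  assumes "finite_simple_graph H" "finite (verts G)" shows "finite (copies H G)"
  unfolding copies_eq_image[OF assms(1)]
  using assms by (intro finite_imageI finite_embeddings) (simp_all add: finite_simple_graph_def)

lemma num_copies_le:
  assumes "finite_simple_graph H" "finite (verts G)"
  shows "num_copies H G \<le> card (verts G) ^ card (verts H)"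
proof -
  have H: "finite (verts H)" using assms(1) by (simp add: finite_simple_graph_def)
  have "num_copies H G \<le> card (embeddings H G)"
    unfolding num_copies_def copies_eq_image[OF assms(1)]
    using finite_embeddings[OF H assms(2)] by (rule card_image_le)
  also have "\<dots> \<le> card (verts H \<rightarrow>\<^sub>E verts G)"
    by (rule card_mono) (use H assms in \<open>auto simp: embeddings_def intro: finite_PiE\<close>)
  also have "\<dots> = card (verts G) ^ card (verts H)" using H by (simp add: card_PiE)
  finally show ?thesis .
qed

lemma copies_mono:
  assumes "verts G \<subseteq> verts G'" "edges G \<subseteq> edges G'"
  shows "copies H G \<subseteq> copies H G'"
  using assms by (auto simp: copies_def subgraph_def)

lemma num_copies_mono:
  assumes "finite_simple_graph H" "finite (verts G')" "verts G \<subseteq> verts G'" "edges G \<subseteq> edges G'"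
  shows "num_copies H G \<le> num_copies H G'"
  unfolding num_copies_def by (intro card_mono finite_copies copies_mono assms)

lemma card_copy_edges:
  assumes "finite_simple_graph H" "H' \<in> copies H G"
  shows "card (edges H') \<le> card (edges H)" "finite (edges H')"
proof -
  obtain f where "H' = image_graph f H" using assms copies_eq_image[OF assms(1)] by blast
  then show "card (edges H') \<le> card (edges H)" "finite (edges H')"
    using finite_edges[OF assms(1)] by (auto simp: image_graph_def card_image_le)
qed

lemma card_edges_le_power2:
  assumes "finite_simple_graph G"
  shows "card (edges G) \<le> card (verts G) ^ 2"
proof -
  have fin: "finite (verts G)" using assms by (auto simp: finite_simple_graph_def)
  have "edges G \<subseteq> (\<lambda>(u, v). {u, v}) ` (verts G \<times> verts G)"
  proof
    fix e assume "e \<in> edges G"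
    then show "e \<in> (\<lambda>(u, v). {u, v}) ` (verts G \<times> verts G)"
      using edgeE[OF assms] by (metis (no_types, lifting) SigmaI case_prod_conv image_eqI)
  qed
  then have "card (edges G) \<le> card ((\<lambda>(u, v). {u, v}) ` (verts G \<times> verts G))"
    using fin by (intro card_mono) auto
  also have "\<dots> \<le> card (verts G \<times> verts G)" using fin by (intro card_image_le) auto
  finally show ?thesis by (simp add: card_cartesian_product power2_eq_square)
qed

text \<open>The vertex set of \<open>K\<close> is its only possible edge, so a copy is determined by
  its edge. The form with a general \<open>K\<close> applies also to \<open>H\<close> itself when
  \<open>H\<close> has two vertices.\<close>

lemma num_copies_single_edge:
  assumes K: "finite_simple_graph K" "card (verts K) = 2" "edges K \<noteq> {}"
    and G: "finite_simple_graph G"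
  shows "num_copies K G = card (edges G)"
proof -
  have finK: "finite (verts K)" using K(1) by (simp add: finite_simple_graph_def)
  have sub: "e = verts K" if "e \<in> edges K" for e
    using K that finK by (auto simp: finite_simple_graph_def card_subset_eq)
  then have eK: "edges K = {verts K}" using K(3) by auto
  obtain a b where ab: "verts K = {a, b}" "a \<noteq> b" using K(2) by (meson card_2_iff)
  have "copies K G = (\<lambda>e. (e, {e})) ` edges G"
  proof (intro equalityI subsetI)
    fix K' assume "K' \<in> copies K G"
    then show "K' \<in> (\<lambda>e. (e, {e})) ` edges G"
      by (auto simp: copies_eq_image[OF K(1)] embeddings_def image_graph_def eK)
  next
    fix K' assume "K' \<in> (\<lambda>e. (e, {e})) ` edges G"
    then obtain e where e: "e \<in> edges G" "K' = (e, {e})" by blast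
    then obtain u v where uv: "e = {u, v}" "u \<noteq> v" "u \<in> verts G" "v \<in> verts G"
      using edgeE[OF G] by metis
    let ?f = "\<lambda>x. if x = a then u else v"
    have "?f ` {a, b} = {u, v}" using ab by auto
    moreover have "inj_on ?f {a, b}" using uv ab by (auto simp: inj_on_def)
    ultimately have "isomorphic K K'"
      using e uv eK ab by (auto simp: isomorphic_def bij_betw_def intro!: exI[of _ ?f])
    moreover have "subgraph K' G"
      using e uv by (auto simp: subgraph_def finite_simple_graph_def)
    ultimately show "K' \<in> copies K G" by (simp add: copies_def)
  qed
  moreover have "inj_on (\<lambda>e. (e, {e})) (edges G)" by (auto simp: inj_on_def)
  ultimately show ?thesis by (simp add: num_copies_def card_image)
qed

lemma complete_graph_2:
  "finite_simple_graph (complete_graph 2)" "card (verts (complete_graph 2)) = 2"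
  "edges (complete_graph 2) \<noteq> {}"
proof -
  show "finite_simple_graph (complete_graph 2)" "card (verts (complete_graph 2)) = 2"
    by (auto simp: complete_graph_def finite_simple_graph_def)
  have "{0, 1} \<in> edges (complete_graph 2)" by (auto simp: complete_graph_def)
  then show "edges (complete_graph 2) \<noteq> {}" by auto
qed

lemma finite_simple_color_subgraph:
  "finite_simple_graph G \<Longrightarrow> finite_simple_graph (color_subgraph x c G)"
  by (auto simp: finite_simple_graph_def color_subgraph_def)

lemma num_copies_col_eq:
  assumes "finite_simple_graph G"
  shows "num_copies_col H (complete_graph 2) G c =
    num_copies H (color_subgraph Red c G) + card {e \<in> edges G. c e = Blue}"
  using num_copies_single_edge[OF complete_graph_2, of "color_subgraph Blue c G"]
    finite_simple_color_subgraph[OF assms]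
  by (simp add: num_copies_col_def color_subgraph_def)

section \<open>Chromatic number and \<open>F\<close>-free graphs\<close>

lemma colorable_mono: "colorable k G \<Longrightarrow> k \<le> l \<Longrightarrow> colorable l G"
  unfolding colorable_def by (meson lessThan_subset_iff subset_trans)

lemma colorable_chromatic_number:
  assumes "finite_simple_graph G" shows "colorable (chromatic_number G) G"
proof -
  have fin: "finite (verts G)" using assms by (auto simp: finite_simple_graph_def)
  obtain f where f: "bij_betw f (verts G) {0..<card (verts G)}"
    using ex_bij_betw_finite_nat[OF fin] by blast
  have "f u \<noteq> f v" if "{u, v} \<in> edges G" for u v
    using edge_doubletonD[OF assms that] f by (metis bij_betw_def inj_on_eq_iff)
  then have "colorable (card (verts G)) G"
    using f by (auto simp: colorable_def bij_betw_def intro!: exI[of _ f])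
  then show ?thesis unfolding chromatic_number_def by (rule LeastI)
qed

lemma chromatic_number_le: "colorable k G \<Longrightarrow> chromatic_number G \<le> k"
  unfolding chromatic_number_def by (rule Least_le)

text \<open>An embedding pulls a colouring of \<open>G\<close> back to \<open>F\<close>. The
  bipartite pattern, the planted graph and the final \<open>T\<close> are seen to be
  \<open>F\<close>-free in this way.\<close>

lemma colorable_free_of:
  assumes F: "finite_simple_graph F" and "colorable k G" "k < chromatic_number F"
  shows "free_of F G"
proof (rule ccontr)
  assume "\<not> free_of F G"
  then obtain f where f: "f \<in> embeddings F G" using free_of_iff[OF F] by blast
  obtain c :: "'b \<Rightarrow> nat" where c: "c ` verts G \<subseteq> {..<k}" "\<And>u v. {u, v} \<in> edges G \<Longrightarrow> c u \<noteq> c v"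
    using assms(2) by (auto simp: colorable_def)
  have "f ` {u, v} \<in> edges G" if "{u, v} \<in> edges F" for u v
    using f that by (auto simp: embeddings_def)
  then have "colorable k F"
    using f c unfolding colorable_def
    by (intro exI[of _ "c \<circ> f"]) (auto simp: embeddings_def PiE_def Pi_def image_subset_iff)
  then show False using chromatic_number_le assms(3) by fastforce
qed

lemma nvertex_edgeless:
  "nvertex_graph n ({..<n}, {})"
  by (auto simp: nvertex_graph_def finite_simple_graph_def)

lemma edgeless_free_of:
  assumes "finite_simple_graph F" "edges F \<noteq> {}" shows "free_of F (V, {})"
  using assms by (auto simp: free_of_iff embeddings_def)

section \<open>Counting copies\<close>

text \<open>Once the values at \<open>q\<close> and \<open>q'\<close> are fixed,
  \<open>card Q - 2\<close> coordinates remain, with \<open>s\<close> choices each.\<close>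

lemma card_PiE_pair_le:
  assumes Q: "finite Q" "q \<in> Q" "q' \<in> Q" "q \<noteq> q'"
    and U: "\<And>q. q \<in> Q \<Longrightarrow> finite (U q) \<and> card (U q) = s" and R: "finite R"
  shows "card {g \<in> Pi\<^sub>E Q U. (g q, g q') \<in> R} \<le> card R * s ^ (card Q - 2)"
proof -
  let ?Q = "Q - {q, q'}"
  let ?f = "\<lambda>g. ((g q, g q'), restrict g ?Q)"
  let ?A = "{g \<in> Pi\<^sub>E Q U. (g q, g q') \<in> R}"
  have inj: "inj_on ?f ?A"
  proof (rule inj_onI)
    fix g g' assume g: "g \<in> ?A" "g' \<in> ?A" and eq: "?f g = ?f g'"
    show "g = g'"
    proof (rule PiE_ext[of _ Q U])
      fix x assume "x \<in> Q"
      show "g x = g' x"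
      proof (cases "x \<in> ?Q")
        case True
        have "restrict g ?Q x = restrict g' ?Q x" using eq by simp
        then show ?thesis using True by simp
      next
        case False
        then show ?thesis using eq \<open>x \<in> Q\<close> by auto
      qed
    qed (use g in auto)
  qed
  have "?f ` ?A \<subseteq> R \<times> Pi\<^sub>E ?Q U"
  proof (rule image_subsetI)
    fix g assume "g \<in> ?A"
    moreover from this have "restrict g ?Q \<in> Pi\<^sub>E ?Q U" by (intro restrict_PiE_iff[THEN iffD2]) auto
    ultimately show "?f g \<in> R \<times> Pi\<^sub>E ?Q U" by simp
  qed
  moreover have fin: "finite (R \<times> Pi\<^sub>E ?Q U)" using Q U R by (intro finite_cartesian_product finite_PiE) auto
  ultimately have "card ?A \<le> card (R \<times> Pi\<^sub>E ?Q U)" using card_inj_on_le[OF inj] by blast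
  also have "\<dots> = card R * (\<Prod>x\<in>?Q. card (U x))"
    using Q by (simp add: card_cartesian_product card_PiE)
  also have "(\<Prod>x\<in>?Q. card (U x)) = s ^ card ?Q" using U by simp
  also have "card ?Q = card Q - 2" using Q by (simp add: card_Diff_subset)
  finally show ?thesis .
qed

text \<open>A union bound: each of the at most \<open>card Q ^ 2\<close> ordered pairs excludes at
  most r s^(|Q|-2) functions, and the bound on \<open>s\<close> keeps the total below half of s^|Q|.
  That half survives, and not just one function, serves both to find an embedding of
  \<open>F\<close> and to count copies of \<open>H\<close>.\<close>

lemma card_PiE_avoiding:
  assumes Q: "finite Q" and U: "\<And>q. q \<in> Q \<Longrightarrow> finite (U q) \<and> card (U q) = s"
    and R: "\<And>q q'. finite (R q q') \<and> card (R q q') \<le> r"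
    and s: "2 * card Q ^ 2 * r \<le> s ^ 2"
  shows "s ^ card Q \<le> 2 * card {g \<in> Pi\<^sub>E Q U. \<forall>q\<in>Q. \<forall>q'\<in>Q. q \<noteq> q' \<longrightarrow> (g q, g q') \<notin> R q q'}"
    (is "_ \<le> 2 * card ?good")
proof -
  define P where "P = {(q, q'). q \<in> Q \<and> q' \<in> Q \<and> q \<noteq> q'}"
  define bad where "bad = (\<Union>(q, q')\<in>P. {g \<in> Pi\<^sub>E Q U. (g q, g q') \<in> R q q'})"
  have "P \<subseteq> Q \<times> Q" by (auto simp: P_def)
  then have P: "finite P" "card P \<le> card Q ^ 2"
    using Q card_mono[of "Q \<times> Q" P] finite_subset[of P "Q \<times> Q"]
    by (auto simp: card_cartesian_product power2_eq_square)
  have fin: "finite (Pi\<^sub>E Q U)" using Q U by (intro finite_PiE) auto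
  have "card bad \<le> (\<Sum>(q, q')\<in>P. card {g \<in> Pi\<^sub>E Q U. (g q, g q') \<in> R q q'})"
    unfolding bad_def by (rule order_trans[OF card_UN_le[OF P(1)]]) (simp add: case_prod_unfold)
  also have "\<dots> \<le> (\<Sum>p\<in>P. r * s ^ (card Q - 2))"
  proof (rule sum_mono, clarify)
    fix q q' assume "(q, q') \<in> P"
    then have "card {g \<in> Pi\<^sub>E Q U. (g q, g q') \<in> R q q'} \<le> card (R q q') * s ^ (card Q - 2)"
      using Q U R by (intro card_PiE_pair_le) (auto simp: P_def)
    also have "\<dots> \<le> r * s ^ (card Q - 2)" using R by simp
    finally show "card {g \<in> Pi\<^sub>E Q U. (g q, g q') \<in> R q q'} \<le> r * s ^ (card Q - 2)" .
  qed
  finally have bad: "card bad \<le> card P * (r * s ^ (card Q - 2))" by simp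
  \<comment> \<open>If \<open>Q\<close> has at most one element, nothing is bad. Otherwise
    \<open>card Q - 2\<close> is a genuine difference and a factor \<open>s ^ 2\<close> splits
    off.\<close>
  have "2 * card bad \<le> s ^ card Q"
  proof (cases "P = {}")
    case True
    then show ?thesis using bad by simp
  next
    case False
    then obtain q q' where "q \<in> Q" "q' \<in> Q" "q \<noteq> q'" by (auto simp: P_def)
    then have "card {q, q'} \<le> card Q" using Q by (intro card_mono) auto
    then have "card Q = 2 + (card Q - 2)" using \<open>q \<noteq> q'\<close> by simp
    then have split: "s ^ card Q = s ^ 2 * s ^ (card Q - 2)" by (metis power_add)
    have "2 * card bad \<le> 2 * (card Q ^ 2 * (r * s ^ (card Q - 2)))"
      using bad P(2) by (meson le_trans mult_le_mono1 mult_le_mono2)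
    also have "\<dots> = (2 * card Q ^ 2 * r) * s ^ (card Q - 2)" by (simp add: ac_simps)
    also have "\<dots> \<le> s ^ card Q" unfolding split by (rule mult_le_mono1[OF s])
    finally show ?thesis .
  qed
  moreover have "s ^ card Q \<le> card ?good + card bad"
  proof -
    have "s ^ card Q = card (Pi\<^sub>E Q U)" using Q U by (simp add: card_PiE)
    also have "\<dots> \<le> card (?good \<union> bad)"
      using fin by (intro card_mono) (auto simp: bad_def P_def intro: finite_subset[OF _ fin])
    also have "\<dots> \<le> card ?good + card bad" by (rule card_Un_le)
    finally show ?thesis .
  qed
  ultimately show ?thesis by simp
qed

section \<open>Copies through a given edge\<close>

text \<open>An embedding whose image contains \<open>e\<close> sends some ordered pair of vertices
  of \<open>H\<close> onto the endpoints of \<open>e\<close>. There are at most h^2 such pairs, and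
  each of the other h - 2 vertices has at most n images.\<close>

lemma card_copies_containing_edge_le:
  assumes H: "finite_simple_graph H" and G: "finite (verts G)"
  shows "card {H' \<in> copies H G. e \<in> edges H'} \<le>
    card (verts H) ^ 2 * card (verts G) ^ (card (verts H) - 2)"
proof (cases "{H' \<in> copies H G. e \<in> edges H'} = {}")
  case False
  have finH: "finite (verts H)" using H by (simp add: finite_simple_graph_def)
  obtain H' where "H' \<in> copies H G" "e \<in> edges H'" using False by blast
  \<comment> \<open>\<open>e\<close> is an arbitrary set; lying in a copy is what makes it a
    pair.\<close>
  then have "card e = 2" by (auto simp: copies_def subgraph_def finite_simple_graph_def)
  then obtain x y where e: "e = {x, y}" "x \<noteq> y" by (meson card_2_iff)
  define P where "P = {(u, v). u \<in> verts H \<and> v \<in> verts H \<and> u \<noteq> v}"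
  define S where "S = (\<lambda>(u, v). {f \<in> verts H \<rightarrow>\<^sub>E verts G. (f u, f v) \<in> {(x, y)}})"
  have "P \<subseteq> verts H \<times> verts H" by (auto simp: P_def)
  then have P: "finite P" "card P \<le> card (verts H) ^ 2"
    using finH card_mono[of "verts H \<times> verts H" P] finite_subset[of P "verts H \<times> verts H"]
    by (auto simp: card_cartesian_product power2_eq_square)
  have finS: "finite (S p)" for p
    proof (rule finite_subset)
    show "S p \<subseteq> verts H \<rightarrow>\<^sub>E verts G" by (auto simp: S_def case_prod_unfold)
    show "finite (verts H \<rightarrow>\<^sub>E verts G)" using finH G by (intro finite_PiE) auto
  qed
  have "{H' \<in> copies H G. e \<in> edges H'} \<subseteq> (\<lambda>f. image_graph f H) ` (\<Union>p\<in>P. S p)"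
  proof
    fix H' assume "H' \<in> {H' \<in> copies H G. e \<in> edges H'}"
    then obtain f where f: "f \<in> embeddings H G" "H' = image_graph f H" "e \<in> edges H'"
      using copies_eq_image[OF H, of G] by blast
    then obtain d where d: "d \<in> edges H" "e = f ` d" by (auto simp: image_graph_def)
    obtain u v where uv: "d = {u, v}" "u \<noteq> v" "u \<in> verts H" "v \<in> verts H"
      using edgeE[OF H d(1)] by metis
    then have "f u = x \<and> f v = y \<or> f v = x \<and> f u = y" using d e by (auto simp: doubleton_eq_iff)
    then have "f \<in> S (u, v) \<or> f \<in> S (v, u)" using f by (auto simp: S_def embeddings_def)
    moreover have "(u, v) \<in> P" "(v, u) \<in> P" using uv by (auto simp: P_def)
    ultimately show "H' \<in> (\<lambda>f. image_graph f H) ` (\<Union>p\<in>P. S p)" using f(2) by blast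
  qed
  then have "card {H' \<in> copies H G. e \<in> edges H'} \<le> card ((\<lambda>f. image_graph f H) ` (\<Union>p\<in>P. S p))"
    using P finS by (intro card_mono) auto
  also have "\<dots> \<le> card (\<Union>p\<in>P. S p)" using P finS by (intro card_image_le) auto
  also have "\<dots> \<le> (\<Sum>p\<in>P. card (S p))" by (rule card_UN_le[OF P(1)])
  also have "\<dots> \<le> (\<Sum>p\<in>P. card (verts G) ^ (card (verts H) - 2))"
  proof (rule sum_mono, clarify)
    fix u v assume "(u, v) \<in> P"
    then show "card (S (u, v)) \<le> card (verts G) ^ (card (verts H) - 2)"
      using card_PiE_pair_le[of "verts H" u v "\<lambda>_. verts G" "card (verts G)" "{(x, y)}"] finH G
      by (auto simp: P_def S_def)
  qed
  also have "\<dots> \<le> card (verts H) ^ 2 * card (verts G) ^ (card (verts H) - 2)" using P by simp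
  finally show ?thesis .
next
  case True
  then show ?thesis by (metis card.empty le0)
qed

text \<open>As the vertex sets agree, a copy can be lost only through one of its edges.\<close>

lemma copies_diff_subset:
  assumes "verts G = verts G'"
  shows "copies H G - copies H G' \<subseteq> (\<Union>e\<in>edges G - edges G'. {H' \<in> copies H G. e \<in> edges H'})"
  using assms by (auto simp: copies_def subgraph_def)

lemma card_copies_diff_le:
  assumes H: "finite_simple_graph H" and G: "finite_simple_graph G" and V: "verts G = verts G'"
  shows "card (copies H G - copies H G') \<le>
    card (edges G - edges G') * (card (verts H) ^ 2 * card (verts G) ^ (card (verts H) - 2))"
proof -
  have fin: "finite (edges G - edges G')" "finite (verts G)"
    using finite_edges[OF G] G by (auto simp: finite_simple_graph_def)
  have "card (copies H G - copies H G') \<le>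
      card (\<Union>e\<in>edges G - edges G'. {H' \<in> copies H G. e \<in> edges H'})"
    using fin finite_copies[OF H fin(2)] by (intro card_mono copies_diff_subset V) auto
  also have "\<dots> \<le> (\<Sum>e\<in>edges G - edges G'. card {H' \<in> copies H G. e \<in> edges H'})"
    by (rule card_UN_le[OF fin(1)])
  also have "\<dots> \<le> card (edges G - edges G') *
      (card (verts H) ^ 2 * card (verts G) ^ (card (verts H) - 2))"
    using sum_bounded_above[OF card_copies_containing_edge_le[OF H fin(2)]] by simp
  finally show ?thesis .
qed

lemma num_copies_le_add_diff:
  assumes H: "finite_simple_graph H" and G: "finite_simple_graph G" and V: "verts G = verts G'"
  shows "num_copies H G \<le> num_copies H G' +
    card (edges G - edges G') * (card (verts H) ^ 2 * card (verts G) ^ (card (verts H) - 2))"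
proof -
  have "finite (verts G)" using G by (simp add: finite_simple_graph_def)
  then have fin: "finite (copies H G)" "finite (copies H G')" using V by (auto intro!: finite_copies H)
  have "num_copies H G \<le> card (copies H G' \<union> (copies H G - copies H G'))"
    unfolding num_copies_def using fin by (intro card_mono) auto
  also have "\<dots> \<le> num_copies H G' + card (copies H G - copies H G')"
    unfolding num_copies_def by (rule card_Un_le)
  finally show ?thesis using card_copies_diff_le[OF assms] by simp
qed

text \<open>Serves to rule out an edgeless \<open>H\<close> under stability: its count does not see
  the edges of the host.\<close>

lemma num_copies_edgeless:
  assumes "edges H = {}" "verts G = verts G'" shows "num_copies H G = num_copies H G'"
proof -
  have "copies H G = copies H G'"
    using assms by (auto simp: copies_def subgraph_def isomorphic_def)
  then show ?thesis by (simp add: num_copies_def)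
qed

text \<open>All embeddings with image \<open>H'\<close> map \<open>verts H\<close> into the
  h-element set \<open>verts H'\<close>, so a fibre has at most h^h elements.\<close>

lemma card_embeddings_le_copies:
  assumes H: "finite_simple_graph H" and C: "finite C" "\<And>f. f \<in> S \<Longrightarrow> image_graph f H \<in> C"
    and S: "S \<subseteq> embeddings H G"
  shows "card S \<le> card C * card (verts H) ^ card (verts H)"
proof -
  let ?h = "card (verts H)"
  have finH: "finite (verts H)" using H by (simp add: finite_simple_graph_def)
  have fib: "finite {f \<in> S. image_graph f H = H'} \<and> card {f \<in> S. image_graph f H = H'} \<le> ?h ^ ?h" for H'
  proof (cases "{f \<in> S. image_graph f H = H'} = {}")
    case False
    then obtain f where "f \<in> S" "image_graph f H = H'" by blast
    then have "verts H' = f ` verts H" "inj_on f (verts H)"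
      using S by (auto simp: image_graph_def embeddings_def)
    then have W: "finite (verts H')" "card (verts H') = ?h" using finH by (auto simp: card_image)
    have fin: "finite (verts H \<rightarrow>\<^sub>E verts H')" using finH W by (intro finite_PiE) auto
    have sub: "{f \<in> S. image_graph f H = H'} \<subseteq> verts H \<rightarrow>\<^sub>E verts H'"
    proof clarify
      fix f assume "f \<in> S" "H' = image_graph f H"
      then show "f \<in> verts H \<rightarrow>\<^sub>E verts (image_graph f H)"
        using S by (auto simp: image_graph_def embeddings_def PiE_iff subset_iff)
    qed
    show ?thesis
      using card_mono[OF fin sub] finite_subset[OF sub fin] finH W by (simp add: card_PiE)
  next
    case True
    then show ?thesis by (metis card.empty finite.emptyI le0)
  qed
  have "S \<subseteq> (\<Union>H'\<in>C. {f \<in> S. image_graph f H = H'})" using C by auto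
  then have "card S \<le> card (\<Union>H'\<in>C. {f \<in> S. image_graph f H = H'})"
    using C fib by (intro card_mono) auto
  also have "\<dots> \<le> (\<Sum>H'\<in>C. card {f \<in> S. image_graph f H = H'})" by (rule card_UN_le[OF C(1)])
  also have "\<dots> \<le> card C * ?h ^ ?h"
    using sum_bounded_above[of C "\<lambda>H'. card {f \<in> S. image_graph f H = H'}"] fib by simp
  finally show ?thesis .
qed

text \<open>Double counting of the pairs of an edge in \<open>E\<close> and a graph in
  \<open>C\<close> containing it.\<close>

lemma card_incidences_le:
  assumes E: "finite E" and C: "finite C"
    and m: "\<And>e. e \<in> E \<Longrightarrow> m \<le> card {K \<in> C. e \<in> edges K}"
    and b: "\<And>K. K \<in> C \<Longrightarrow> finite (edges K) \<and> card (edges K) \<le> b"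
  shows "card E * m \<le> card C * b"
proof -
  have "card E * m \<le> (\<Sum>e\<in>E. card {K \<in> C. e \<in> edges K})"
    using sum_bounded_below[OF m] by simp
  also have "\<dots> = (\<Sum>K\<in>C. card {e \<in> E. e \<in> edges K})" by (rule sum_multicount_gen[OF E C]) auto
  also have "\<dots> \<le> card C * b"
  proof -
    have "card {e \<in> E. e \<in> edges K} \<le> b" if "K \<in> C" for K
    proof -
      have "card {e \<in> E. e \<in> edges K} \<le> card (edges K)" using b[OF that] by (intro card_mono) auto
      then show ?thesis using b[OF that] by simp
    qed
    then show ?thesis using sum_bounded_above[of C "\<lambda>K. card {e \<in> E. e \<in> edges K}" b] by simp
  qed
  finally show ?thesis .
qed

section \<open>Rainbow-free families and coloured graphs\<close>

text \<open>A form of Koenig's theorem: \<open>S\<close> consists of the members of \<open>A\<close> reachable by alternating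
  paths from the unmatched ones, and \<open>(A - S) \<union> (B \<inter> (\<Union>h\<in>S. N h))\<close> is a minimum vertex cover.\<close>

lemma maximum_matching_cover:
  fixes N :: "'h \<Rightarrow> 'e set"
  assumes E: "finite E" and A: "finite A"
  obtains B \<phi> S where "B \<subseteq> E" "inj_on \<phi> B" "\<phi> ` B \<subseteq> A" "\<And>e. e \<in> B \<Longrightarrow> e \<in> N (\<phi> e)"
    "S \<subseteq> A" "\<And>h. h \<in> S \<Longrightarrow> N h \<inter> E \<subseteq> B" "card (A - S) \<le> card (B - (\<Union>h\<in>S. N h))"
proof -
  \<comment> \<open>The matching is read from elements to members: \<open>B\<close> is the set of
    matched elements, and the injection \<phi> sends each of them to a member whose set contains
    it.\<close>
  define valid where "valid = (\<lambda>B \<phi>. B \<subseteq> E \<and> inj_on \<phi> B \<and> \<phi> ` B \<subseteq> A \<and> (\<forall>e\<in>B. e \<in> N (\<phi> e)))"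
  define matched where "matched = (\<lambda>B. \<exists>\<phi>. valid B \<phi>)"
  have "matched {}" by (auto simp: valid_def matched_def)
  moreover have "\<forall>B. matched B \<longrightarrow> card B < Suc (card E)"
    unfolding less_Suc_eq_le using E by (auto simp: valid_def matched_def intro: card_mono)
  ultimately obtain B where "matched B" and max: "\<And>B'. matched B' \<Longrightarrow> card B' \<le> card B"
    using Lattices_Big.ex_has_greatest_nat[of matched "{}" card "Suc (card E)"] by blast
  then obtain \<phi> where \<phi>: "valid B \<phi>" by (auto simp: matched_def)
  have finB: "finite B" using \<phi> E by (auto simp: valid_def intro: finite_subset)
  \<comment> \<open>\<open>r\<close> leads from \<open>g\<close> to a member matched with an element
    of \<open>N g\<close>. Thus \<open>L n\<close> collects the ends of alternating walks with
    \<open>n\<close> such steps from unmatched members.\<close>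
  define r where "r = {(g, h). \<exists>e\<in>N g \<inter> B. \<phi> e = h}"
  define L where "L = (\<lambda>n. {h. \<exists>h0\<in>A - \<phi> ` B. (h0, h) \<in> r ^^ n})"
  define S where "S = (\<Union>n. L n)"
  have rA: "h \<in> A" if "(g, h) \<in> r" for g h using that \<phi> by (auto simp: r_def valid_def)
  have LA: "L n \<subseteq> A" for n by (cases n) (auto simp: L_def dest: rA)
  have step: "h \<in> L (Suc n)" if "g \<in> L n" "(g, h) \<in> r" for g h n using that by (auto simp: L_def)
  \<comment> \<open>Shifting the matching along a shortest alternating path leaves \<open>h\<close>
    unmatched and keeps \<open>B\<close>. The last clause says that only elements matched to members
    at distance at most \<open>n\<close> were reassigned; hence in the induction step the element
    matched to \<open>h\<close>, at distance n + 1, is still matched to \<open>h\<close>.\<close>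
  have shift: "\<exists>\<psi>. valid B \<psi> \<and> h \<notin> \<psi> ` B \<and> (\<forall>e\<in>B. \<psi> e \<noteq> \<phi> e \<longrightarrow> (\<exists>m\<le>n. \<phi> e \<in> L m))"
    if "h \<in> L n" "\<And>m. m < n \<Longrightarrow> h \<notin> L m" for h n
    using that
  proof (induction n arbitrary: h)
    case 0
    then show ?case using \<phi> by (intro exI[of _ \<phi>]) (auto simp: L_def)
  next
    case (Suc n)
    then obtain g where g: "g \<in> L n" "(g, h) \<in> r" by (auto simp: L_def)
    have "g \<notin> L m" if "m < n" for m using Suc.prems(2)[of "Suc m"] step g(2) that by blast
    then obtain \<psi> where \<psi>: "valid B \<psi>" "g \<notin> \<psi> ` B"
      "\<And>e. e \<in> B \<Longrightarrow> \<psi> e \<noteq> \<phi> e \<Longrightarrow> \<exists>m\<le>n. \<phi> e \<in> L m"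
      using Suc.IH[OF g(1)] by blast
    obtain e where e: "e \<in> N g" "e \<in> B" "\<phi> e = h" using g(2) by (auto simp: r_def)
    have "\<psi> e = h" using \<psi>(3)[OF e(2)] e(3) Suc.prems(2) by (metis less_Suc_eq_le)
    have "g \<noteq> h" using Suc.prems(2)[of n] g(1) by auto
    let ?\<psi> = "\<psi>(e := g)"
    have "valid B ?\<psi>" using \<psi>(1,2) e g LA[of n] by (auto simp: valid_def inj_on_def)
    moreover have "h \<notin> ?\<psi> ` B"
      using \<psi>(1) e(2) \<open>\<psi> e = h\<close> \<open>g \<noteq> h\<close> by (auto simp: valid_def inj_on_def)
    moreover have "\<exists>m\<le>Suc n. \<phi> d \<in> L m" if "d \<in> B" "?\<psi> d \<noteq> \<phi> d" for d
      using \<psi>(3)[of d] that e(3) Suc.prems(1) by (metis fun_upd_other le_SucI le_refl)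
    ultimately show ?case by blast
  qed
  have NB: "N h \<inter> E \<subseteq> B" if "h \<in> S" for h
  proof
    fix e assume e: "e \<in> N h \<inter> E"
    have "\<exists>n. h \<in> L n" using that by (auto simp: S_def)
    then obtain n where "h \<in> L n" "\<And>m. m < n \<Longrightarrow> h \<notin> L m"
      using exists_least_iff[of "\<lambda>n. h \<in> L n"] by blast
    then obtain \<psi> where \<psi>: "valid B \<psi>" "h \<notin> \<psi> ` B" using shift by blast
    show "e \<in> B"
    proof (rule ccontr)
      assume "e \<notin> B"
      have "h \<in> A" using \<open>h \<in> L n\<close> LA by blast
      \<comment> \<open>Since \<open>h\<close> has been freed, an element of \<open>N h\<close>
        outside \<open>B\<close> would enlarge the maximum matching.\<close>
      then have "valid (insert e B) (\<psi>(e := h))"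
        using \<psi> e \<open>e \<notin> B\<close> by (auto simp: valid_def inj_on_def)
      then have "card (insert e B) \<le> card B" by (intro max) (auto simp: matched_def)
      then show False using \<open>e \<notin> B\<close> finB by simp
    qed
  qed
  \<comment> \<open>Unmatched members form \<open>L 0\<close>, so a member outside \<open>S\<close>
    is matched. Its element avoids \<open>N g\<close> for every \<open>g\<close> in
    \<open>S\<close>, since otherwise one more step would reach the member.\<close>
  have "A - S \<subseteq> \<phi> ` (B - (\<Union>h\<in>S. N h))"
  proof
    fix h assume h: "h \<in> A - S"
    have "h \<notin> L 0" using h by (auto simp: S_def)
    then obtain e where e: "e \<in> B" "h = \<phi> e" using h by (auto simp: L_def)
    have "e \<notin> N g" if "g \<in> S" for g
    proof
      assume "e \<in> N g"
      then have "(g, h) \<in> r" using e by (auto simp: r_def)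
      then have "h \<in> S" using that step by (auto simp: S_def)
      then show False using h by blast
    qed
    then show "h \<in> \<phi> ` (B - (\<Union>h\<in>S. N h))" using e by blast
  qed
  then have "card (A - S) \<le> card (\<phi> ` (B - (\<Union>h\<in>S. N h)))" using finB by (intro card_mono) auto
  also have "\<dots> \<le> card (B - (\<Union>h\<in>S. N h))" using finB by (intro card_image_le) auto
  finally have "card (A - S) \<le> card (B - (\<Union>h\<in>S. N h))" .
  moreover have "S \<subseteq> A" using LA by (auto simp: S_def)
  ultimately show ?thesis using that[of B \<phi> S] \<phi> NB by (auto simp: valid_def)
qed

text \<open>The matching itself makes every subgraph with edges in \<open>B\<close> rainbow, so
  \<open>B\<close> spans no \<open>F\<close>. The members in \<open>S\<close> have all their edges
  in \<open>B\<close> and these are red, so they are red copies of \<open>H\<close>; the remaining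
  members are no more numerous than the blue edges.\<close>

lemma rainbow_free_family_le_col:
  assumes H: "finite_simple_graph H" and G: "finite_simple_graph G"
    and fam: "\<H> \<subseteq> copies H G" and norb: "\<And>F'. F' \<in> copies F G \<Longrightarrow> \<not> rainbow \<H> F'"
  obtains G' c where "verts G' = verts G" "finite_simple_graph G'" "free_of F G'"
    "card \<H> \<le> num_copies_col H (complete_graph 2) G' c"
proof -
  have finV: "finite (verts G)" using G by (simp add: finite_simple_graph_def)
  have finH: "finite \<H>" using finite_copies[OF H finV] fam by (rule finite_subset[rotated])
  obtain B \<phi> S where B: "B \<subseteq> edges G" "inj_on \<phi> B" "\<phi> ` B \<subseteq> \<H>" "\<And>e. e \<in> B \<Longrightarrow> e \<in> edges (\<phi> e)"
    and S: "S \<subseteq> \<H>" "\<And>h. h \<in> S \<Longrightarrow> edges h \<inter> edges G \<subseteq> B"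
      "card (\<H> - S) \<le> card (B - (\<Union>h\<in>S. edges h))"
    using maximum_matching_cover[OF finite_edges[OF G] finH, of edges] by metis
  define G' where "G' = (verts G, B)"
  define c where "c = (\<lambda>e. if e \<in> (\<Union>h\<in>S. edges h) then Red else Blue)"
  have G': "finite_simple_graph G'" using G B(1) by (auto simp: G'_def finite_simple_graph_def)
  have finB: "finite B" using B(1) finite_edges[OF G] by (rule finite_subset)
  have "copies F G' = {}"
  proof (rule ccontr)
    assume "copies F G' \<noteq> {}"
    then obtain F' where F': "F' \<in> copies F G'" by blast
    then have "edges F' \<subseteq> B" by (auto simp: copies_def subgraph_def G'_def)
    then have "rainbow \<H> F'"
      using B by (auto simp: rainbow_def intro!: exI[of _ \<phi>] intro: inj_on_subset)
    moreover have "F' \<in> copies F G" using F' copies_mono[of G' G F] B(1) by (auto simp: G'_def)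
    ultimately show False using norb by blast
  qed
  then have free: "free_of F G'" by (simp add: free_of_def)
  have "S \<subseteq> copies H (color_subgraph Red c G')"
  proof
    fix h assume h: "h \<in> S"
    then have "h \<in> copies H G" using S(1) fam by blast
    moreover from this have "edges h \<subseteq> B"
      using S(2)[OF h] by (auto simp: copies_def subgraph_def)
    ultimately show "h \<in> copies H (color_subgraph Red c G')"
      using h by (auto simp: copies_def subgraph_def color_subgraph_def G'_def c_def)
  qed
  then have "card S \<le> num_copies H (color_subgraph Red c G')"
    unfolding num_copies_def using finV
    by (intro card_mono finite_copies H) (auto simp: color_subgraph_def G'_def)
  moreover have "card (\<H> - S) \<le> card {e \<in> edges G'. c e = Blue}"
  proof (rule order_trans[OF S(3)], rule card_mono)
    show "finite {e \<in> edges G'. c e = Blue}" using finB by (simp add: G'_def)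
  qed (auto simp: G'_def c_def)
  moreover have "card \<H> = card S + card (\<H> - S)"
    using card_Un_disjoint[of S "\<H> - S"] S(1) finH finite_subset[OF S(1) finH]
    by (simp add: Un_absorb1)
  ultimately have "card \<H> \<le> num_copies_col H (complete_graph 2) G' c"
    by (simp add: num_copies_col_eq[OF G'])
  then show ?thesis using that[of G' c] G' free by (auto simp: G'_def)
qed

section \<open>The extremal numbers as attained maxima\<close>

lemma finite_bounded_values:
  assumes "\<And>x. x \<in> A \<Longrightarrow> x \<le> (b::nat)" shows "finite A"
  using assms by (meson finite_nat_set_iff_bounded_le)

context
  fixes H :: "'a ugraph" and F :: "'b ugraph"
  assumes H: "finite_simple_graph H" and F: "finite_simple_graph F" and edgesF: "edges F \<noteq> {}"
begin

lemma finite_ex_values: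
  "finite {num_copies H G | G :: nat ugraph. nvertex_graph n G \<and> free_of F G}"
  by (rule finite_bounded_values[of _ "n ^ card (verts H)"])
    (use num_copies_le[OF H] in \<open>fastforce simp: nvertex_graph_def finite_simple_graph_def\<close>)

lemma finite_rb_values:
  "finite {card \<H> | (G :: nat ugraph) \<H>. nvertex_graph n G \<and> \<H> \<subseteq> copies H G \<and>
     (\<forall>F'\<in>copies F G. \<not> rainbow \<H> F')}"
proof (rule finite_bounded_values[of _ "n ^ card (verts H)"], clarify)
  fix G :: "nat ugraph" and \<H>
  assume G: "nvertex_graph n G" and fam: "\<H> \<subseteq> copies H G"
  then have "finite (verts G)" by (auto simp: nvertex_graph_def finite_simple_graph_def)
  then have "card \<H> \<le> num_copies H G" unfolding num_copies_def by (intro card_mono finite_copies H fam)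
  also have "\<dots> \<le> n ^ card (verts H)"
    using num_copies_le[OF H \<open>finite (verts G)\<close>] G by (simp add: nvertex_graph_def)
  finally show "card \<H> \<le> n ^ card (verts H)" .
qed

lemma finite_ex_col_values:
  "finite {num_copies_col H (complete_graph 2) G c | (G :: nat ugraph) c.
     nvertex_graph n G \<and> free_of F G}"
proof (rule finite_bounded_values[of _ "n ^ card (verts H) + n ^ 2"], clarify)
  fix G :: "nat ugraph" and c
  assume G: "nvertex_graph n G"
  then have simple: "finite_simple_graph G" by (simp add: nvertex_graph_def)
  have "finite (verts G)" using simple by (simp add: finite_simple_graph_def)
  then have "num_copies H (color_subgraph Red c G) \<le> n ^ card (verts H)"
    using num_copies_le[OF H, of "color_subgraph Red c G"] G
    by (simp add: nvertex_graph_def color_subgraph_def)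
  moreover have "card {e \<in> edges G. c e = Blue} \<le> n ^ 2"
    using card_edges_le_power2[OF finite_simple_color_subgraph[OF simple, of Blue c]] G
    by (simp add: nvertex_graph_def color_subgraph_def)
  ultimately show "num_copies_col H (complete_graph 2) G c \<le> n ^ card (verts H) + n ^ 2"
    by (simp add: num_copies_col_eq[OF simple])
qed

lemma num_copies_le_ex:
  fixes G :: "nat ugraph"
  assumes "nvertex_graph n G" "free_of F G" shows "num_copies H G \<le> ex n H F"
  unfolding ex_def by (rule Max_ge[OF finite_ex_values]) (use assms in blast)

lemma ex_attained:
  obtains G :: "nat ugraph" where "nvertex_graph n G" "free_of F G" "ex n H F = num_copies H G"
proof -
  have "ex n H F \<in> {num_copies H G | G :: nat ugraph. nvertex_graph n G \<and> free_of F G}"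
    unfolding ex_def
    by (rule Max_in[OF finite_ex_values]) (use nvertex_edgeless edgeless_free_of[OF F edgesF] in blast)
  then show ?thesis using that by blast
qed

lemma ex_le_rb: "ex n H F \<le> rb n H F"
proof -
  obtain G :: "nat ugraph" where G: "nvertex_graph n G" "free_of F G" "ex n H F = num_copies H G"
    using ex_attained .
  then show ?thesis unfolding G(3) num_copies_def rb_def free_of_def
    by (intro Max_ge finite_rb_values) blast
qed

lemma ex_col_attained:
  obtains G :: "nat ugraph" and c where "nvertex_graph n G" "free_of F G"
    "ex_col n H (complete_graph 2) F = num_copies_col H (complete_graph 2) G c"
proof -
  have "ex_col n H (complete_graph 2) F \<in> {num_copies_col H (complete_graph 2) G c |
      (G :: nat ugraph) c. nvertex_graph n G \<and> free_of F G}"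
    unfolding ex_col_def
    by (rule Max_in[OF finite_ex_col_values])
      (use nvertex_edgeless edgeless_free_of[OF F edgesF] in blast)
  then show ?thesis using that by blast
qed

lemma rb_le_ex_col: "rb n H F \<le> ex_col n H (complete_graph 2) F"
proof -
  let ?V = "{card \<H> | (G :: nat ugraph) \<H>. nvertex_graph n G \<and> \<H> \<subseteq> copies H G \<and>
     (\<forall>F'\<in>copies F G. \<not> rainbow \<H> F')}"
  have "card ({} :: nat ugraph set) \<in> ?V"
    using nvertex_edgeless[of n] edgeless_free_of[OF F edgesF, of "{..<n}"]
    unfolding free_of_def by blast
  then have "rb n H F \<in> ?V" unfolding rb_def by (intro Max_in finite_rb_values) blast
  then obtain G :: "nat ugraph" and \<H> where G: "rb n H F = card \<H>" "nvertex_graph n G"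
    "\<H> \<subseteq> copies H G" "\<And>F'. F' \<in> copies F G \<Longrightarrow> \<not> rainbow \<H> F'" by blast
  then have "finite_simple_graph G" by (simp add: nvertex_graph_def)
  then obtain G' c where G': "verts G' = verts G" "finite_simple_graph G'" "free_of F G'"
    "card \<H> \<le> num_copies_col H (complete_graph 2) G' c"
    using rainbow_free_family_le_col[OF H _ G(3), of F] G(4) by metis
  have "num_copies_col H (complete_graph 2) G' c \<le> ex_col n H (complete_graph 2) F"
  proof (unfold ex_col_def, rule Max_ge[OF finite_ex_col_values])
    have "nvertex_graph n G'" using G' G(2) by (simp add: nvertex_graph_def)
    then show "num_copies_col H (complete_graph 2) G' c \<in>
        {num_copies_col H (complete_graph 2) G c | (G :: nat ugraph) c.
          nvertex_graph n G \<and> free_of F G}"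
      using G'(3) by blast
  qed
  then show ?thesis using G(1) G'(4) by simp
qed

end

section \<open>Complete multipartite graphs and edit distance\<close>

text \<open>Encoded by a class function: parts may be empty, and moving a vertex is the update
  \<open>p(x := j)\<close>. Nonempty parts, as in \<open>complete_multipartite\<close>, correspond
  to \<open>p\<close> mapping \<open>V\<close> onto \<open>{..<k}\<close>.\<close>

definition partite_graph :: "'a set \<Rightarrow> ('a \<Rightarrow> nat) \<Rightarrow> 'a ugraph" where
  "partite_graph V p = (V, {{u, v} | u v. u \<in> V \<and> v \<in> V \<and> p u \<noteq> p v})"

lemma verts_partite_graph [simp]: "verts (partite_graph V p) = V"
  by (simp add: partite_graph_def)

lemma partite_edge_iff [simp]:
  "{u, v} \<in> edges (partite_graph V p) \<longleftrightarrow> u \<in> V \<and> v \<in> V \<and> p u \<noteq> p v"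
  by (auto simp: partite_graph_def doubleton_eq_iff)

lemma finite_simple_partite_graph:
  "finite V \<Longrightarrow> finite_simple_graph (partite_graph V p)"
  by (auto simp: finite_simple_graph_def partite_graph_def card_2_iff)

lemma colorable_partite_graph:
  "p ` V \<subseteq> {..<k} \<Longrightarrow> colorable k (partite_graph V p)"
  unfolding colorable_def by (intro exI[of _ p]) simp

lemma complete_multipartite_partite_graph:
  assumes "finite V" and p: "p ` V = {..<k}"
  shows "complete_multipartite k (partite_graph V p)"
proof -
  let ?A = "\<lambda>i. {x \<in> V. p x = i}"
  let ?P = "?A ` {..<k}"
  have ne: "?A i \<noteq> {}" if "i < k" for i
  proof -
    have "i \<in> p ` V" using that p by simp
    then show ?thesis by auto
  qed
  have "partition_on V ?P"
    unfolding partition_on_def disjoint_def using p ne by auto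
  moreover have "inj_on ?A {..<k}"
    by (rule inj_onI) (use ne in auto)
  then have "card ?P = k" by (simp add: card_image)
  moreover have "edges (partite_graph V p) =
      {{u, v} | u v. \<exists>A\<in>?P. \<exists>B\<in>?P. A \<noteq> B \<and> u \<in> A \<and> v \<in> B}" (is "_ = ?E")
  proof (intro equalityI subsetI)
    fix e assume "e \<in> edges (partite_graph V p)"
    then obtain u v where uv: "e = {u, v}" "u \<in> V" "v \<in> V" "p u \<noteq> p v"
      by (auto simp: partite_graph_def)
    then have "?A (p u) \<in> ?P" "?A (p v) \<in> ?P" "?A (p u) \<noteq> ?A (p v)" using p by auto
    moreover have "u \<in> ?A (p u)" "v \<in> ?A (p v)" using uv by auto
    ultimately have "\<exists>A\<in>?P. \<exists>B\<in>?P. A \<noteq> B \<and> u \<in> A \<and> v \<in> B" by (intro bexI conjI)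
    then show "e \<in> ?E" using uv(1) by (intro CollectI exI conjI)
  next
    fix e assume "e \<in> ?E"
    then obtain u v A B where uv: "e = {u, v}" "A \<in> ?P" "B \<in> ?P" "A \<noteq> B" "u \<in> A" "v \<in> B"
      by blast
    then show "e \<in> edges (partite_graph V p)" by auto
  qed
  ultimately show ?thesis
    unfolding complete_multipartite_def verts_partite_graph
    using finite_simple_partite_graph[OF assms(1), of p] by blast
qed

lemma complete_multipartiteE:
  assumes "complete_multipartite k T"
  obtains p where "T = partite_graph (verts T) p" "p ` verts T = {..<k}"
proof -
  obtain P where P: "partition_on (verts T) P" "card P = k"
    and ed: "edges T = {{u, v} | u v. \<exists>A\<in>P. \<exists>B\<in>P. A \<noteq> B \<and> u \<in> A \<and> v \<in> B}"
    and fin: "finite (verts T)"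
    using assms by (auto simp: complete_multipartite_def finite_simple_graph_def)
  have "finite P" using P(1) fin by (rule finite_elements[rotated])
  then obtain f where f: "bij_betw f P {..<k}"
    using ex_bij_betw_finite_nat[of P] P(2) by (auto simp: atLeast0LessThan)
  define p where "p = (\<lambda>x. f (THE A. A \<in> P \<and> x \<in> A))"
  have p: "p x = f A" if "x \<in> A" "A \<in> P" for x A
  proof -
    have "(THE A. A \<in> P \<and> x \<in> A) = A"
      using that P(1) by (intro the_equality) (auto simp: partition_on_def disjoint_def)
    then show ?thesis by (simp add: p_def)
  qed
  have part: "\<exists>A\<in>P. x \<in> A" if "x \<in> verts T" for x using P(1) that by (auto simp: partition_on_def)
  have sub: "x \<in> verts T" if "x \<in> A" "A \<in> P" for x A using P(1) that by (auto simp: partition_on_def)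
  have inj: "f A = f B \<longleftrightarrow> A = B" if "A \<in> P" "B \<in> P" for A B
    using f that by (auto simp: bij_betw_def inj_on_def)
  have "p ` verts T = {..<k}"
  proof (intro equalityI subsetI)
    fix i assume "i \<in> p ` verts T"
    then show "i \<in> {..<k}" using part p f by (metis bij_betwE imageE)
  next
    fix i assume "i \<in> {..<k}"
    then have "i \<in> f ` P" using f by (simp add: bij_betw_def)
    then obtain A where A: "A \<in> P" "f A = i" by blast
    moreover have "A \<noteq> {}" using P(1) A(1) by (auto simp: partition_on_def)
    moreover from this obtain x where "x \<in> A" by blast
    ultimately show "i \<in> p ` verts T" using p sub by (metis image_eqI)
  qed
  moreover have "edges T = edges (partite_graph (verts T) p)"
  proof (intro equalityI subsetI)
    fix e assume "e \<in> edges T"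
    then obtain u v A B where "e = {u, v}" "A \<in> P" "B \<in> P" "A \<noteq> B" "u \<in> A" "v \<in> B"
      using ed by auto
    then show "e \<in> edges (partite_graph (verts T) p)" using p sub inj by simp
  next
    fix e assume "e \<in> edges (partite_graph (verts T) p)"
    then obtain u v where uv: "e = {u, v}" "u \<in> verts T" "v \<in> verts T" "p u \<noteq> p v"
      by (auto simp: partite_graph_def)
    obtain A B where "A \<in> P" "B \<in> P" "u \<in> A" "v \<in> B" using part uv by meson
    moreover from this have "A \<noteq> B" using p uv(4) by metis
    ultimately have "\<exists>A\<in>P. \<exists>B\<in>P. A \<noteq> B \<and> u \<in> A \<and> v \<in> B" by (intro bexI conjI)
    then show "e \<in> edges T" unfolding ed using uv(1) by (intro CollectI exI conjI)
  qed
  ultimately show ?thesis using that[of p] by (simp add: prod_eq_iff)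
qed

section \<open>Edit distance to complete multipartite graphs\<close>

text \<open>Any admissible \<open>D\<close> and \<open>A\<close> contain the two differences. This
  is the useful direction, because stability bounds the edit distance from above.\<close>

lemma edit_distance_ge:
  assumes "finite (edges G)" "finite (edges T)"
  shows "card (edges G - edges T) + card (edges T - edges G) \<le> edit_distance G T"
proof -
  let ?P = "\<lambda>m. \<exists>D A. finite D \<and> finite A \<and> edges T = (edges G - D) \<union> A \<and> m = card D + card A"
  have "?P (card (edges G) + card (edges T))"
    using assms by (intro exI[of _ "edges G"] exI[of _ "edges T"]) auto
  then have "?P (edit_distance G T)" unfolding edit_distance_def by (rule LeastI)
  then obtain D A where DA: "finite D" "finite A" "edges T = (edges G - D) \<union> A"
    "edit_distance G T = card D + card A" by blast
  have "card (edges G - edges T) \<le> card D" using DA by (intro card_mono) auto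
  moreover have "card (edges T - edges G) \<le> card A" using DA by (intro card_mono) auto
  ultimately show ?thesis using DA(4) by simp
qed

text \<open>Non-adjacency is transitive in a complete multipartite graph, so every triple in
  \<open>A \<times> B \<times> C\<close> contains an edited pair.\<close>

lemma far_from_partite:
  fixes G :: "'a ugraph"
  assumes G: "finite_simple_graph G"
    and sub: "A \<subseteq> verts G" "B \<subseteq> verts G" "C \<subseteq> verts G"
    and disj: "A \<inter> B = {}" "A \<inter> C = {}" "B \<inter> C = {}"
    and card: "card A = m" "card B = m" "card C = m"
    and adj: "\<And>a b. a \<in> A \<Longrightarrow> b \<in> B \<Longrightarrow> {a, b} \<in> edges G"
    and nadj: "\<And>a c. a \<in> A \<Longrightarrow> c \<in> C \<Longrightarrow> {a, c} \<notin> edges G"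
      "\<And>b c. b \<in> B \<Longrightarrow> c \<in> C \<Longrightarrow> {b, c} \<notin> edges G"
  shows "m ^ 3 \<le> (card (edges G - edges (partite_graph (verts G) q)) +
    card (edges (partite_graph (verts G) q) - edges G)) * card (verts G)" (is "_ \<le> ?d * _")
proof -
  let ?T = "partite_graph (verts G) q"
  define D where "D = (edges G - edges ?T) \<union> (edges ?T - edges G)"
  have finV: "finite (verts G)" using G by (simp add: finite_simple_graph_def)
  have finD: "finite D"
    using finite_edges[OF G] finite_edges[OF finite_simple_partite_graph[OF finV, of q]]
    by (simp add: D_def)
  \<comment> \<open>Charges a triple to one of its edited pairs together with the third vertex. The
    triple can be recovered, because \<open>A\<close>, \<open>B\<close> and \<open>C\<close> are
    disjoint.\<close>
  define g where "g = (\<lambda>(a, b, c). if {a, b} \<in> D then ({a, b}, c)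
    else if {a, c} \<in> D then ({a, c}, b) else ({b, c}, a))"
  have edited: "{a, b} \<in> D \<or> {a, c} \<in> D \<or> {b, c} \<in> D" if "a \<in> A" "b \<in> B" "c \<in> C" for a b c
  proof -
    have "a \<in> verts G" "b \<in> verts G" "c \<in> verts G" using that sub by auto
    then show ?thesis using adj nadj that by (auto simp: D_def)
  qed
  have neq: "a \<noteq> b" "a \<noteq> c" "b \<noteq> c" if "a \<in> A" "b \<in> B" "c \<in> C" for a b c
    using that disj by auto
  have "inj_on g (A \<times> B \<times> C)"
  proof (rule inj_onI)
    fix x y assume "x \<in> A \<times> B \<times> C" "y \<in> A \<times> B \<times> C" "g x = g y"
    then obtain a b c a' b' c' where xy: "x = (a, b, c)" "y = (a', b', c')"
      and t: "a \<in> A" "b \<in> B" "c \<in> C" "a' \<in> A" "b' \<in> B" "c' \<in> C"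
      and eq: "g (a, b, c) = g (a', b', c')" by auto
    have "fst (g (a, b, c)) \<union> {snd (g (a, b, c))} = {a, b, c}" for a b c by (auto simp: g_def)
    then have "{a, b, c} = {a', b', c'}" using eq by metis
    then have "a \<in> {a', b', c'}" "b \<in> {a', b', c'}" "c \<in> {a', b', c'}" by blast+
    then show "x = y" unfolding xy
      using neq[OF t(1,5,3)] neq[OF t(1,2,6)] neq[OF t(4,2,6)] neq[OF t(4,2,3)] neq[OF t(4,5,3)]
        neq[OF t(1,5,6)] by simp
  qed
  moreover have "g ` (A \<times> B \<times> C) \<subseteq> D \<times> verts G"
  proof (rule image_subsetI)
    fix x assume "x \<in> A \<times> B \<times> C"
    then obtain a b c where x: "x = (a, b, c)" "a \<in> A" "b \<in> B" "c \<in> C" by auto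
    then show "g x \<in> D \<times> verts G" using edited[OF x(2-4)] sub by (auto simp: g_def)
  qed
  ultimately have "card (A \<times> B \<times> C) \<le> card (D \<times> verts G)"
    using finD finV by (intro card_inj_on_le[of g]) auto
  then have "m ^ 3 \<le> card D * card (verts G)"
    by (simp add: card_cartesian_product card power3_eq_cube)
  moreover have "card D \<le> ?d" unfolding D_def by (rule card_Un_le)
  ultimately show ?thesis by (meson le_trans mult_le_mono1)
qed

lemma obtain_three_disjoint_subsets:
  assumes "3 * m \<le> card U"
  obtains A B C where "A \<subseteq> U" "B \<subseteq> U" "C \<subseteq> U" "A \<inter> B = {}" "A \<inter> C = {}" "B \<inter> C = {}"
    "card A = m" "card B = m" "card C = m"
proof -
  obtain A where A: "A \<subseteq> U" "card A = m" "finite A"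
    using obtain_subset_with_card_n[of m U] assms by auto
  have "2 * m \<le> card (U - A)" using assms A by (simp add: card_Diff_subset)
  then obtain B where B: "B \<subseteq> U - A" "card B = m" "finite B"
    using obtain_subset_with_card_n[of m "U - A"] by auto
  have "m \<le> card (U - A - B)" using \<open>2 * m \<le> card (U - A)\<close> B by (simp add: card_Diff_subset)
  then obtain C where C: "C \<subseteq> U - A - B" "card C = m"
    using obtain_subset_with_card_n[of m "U - A - B"] by auto
  show ?thesis by (rule that[of A B C]) (use A B C in auto)
qed

section \<open>Consequences of stability\<close>

text \<open>Stability in the form used below: a class function instead of the graph
  \<open>T\<close>, and the two edge differences instead of the edit distance.\<close>

lemma weakly_Turan_stable_structure:
  fixes F :: "'b ugraph" and H :: "'a ugraph"
  assumes "weakly_Turan_stable F H" "\<epsilon> > 0"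
  obtains \<delta> :: real and n\<^sub>0 :: nat where "\<delta> > 0"
    "\<And>n (G :: nat ugraph). n \<ge> n\<^sub>0 \<Longrightarrow> nvertex_graph n G \<Longrightarrow> free_of F G \<Longrightarrow>
       real (num_copies H G) \<ge> real (ex n H F) - \<delta> * real n ^ card (verts H) \<Longrightarrow>
       \<exists>p. p ` verts G = {..<chromatic_number F - 1} \<and>
         real (card (edges G - edges (partite_graph (verts G) p)) +
               card (edges (partite_graph (verts G) p) - edges G)) \<le> \<epsilon> * real n ^ 2"
proof -
  obtain \<delta> :: real and n\<^sub>0 :: nat where \<delta>: "\<delta> > 0"
    and stab: "\<And>n (G :: nat ugraph). n \<ge> n\<^sub>0 \<Longrightarrow> nvertex_graph n G \<Longrightarrow> free_of F G \<Longrightarrow>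
       real (num_copies H G) \<ge> real (ex n H F) - \<delta> * real n ^ card (verts H) \<Longrightarrow>
       \<exists>T. complete_multipartite (chromatic_number F - 1) T \<and> verts T = verts G \<and>
             real (edit_distance G T) \<le> \<epsilon> * real n ^ 2"
    using assms unfolding weakly_Turan_stable_def by meson
  show ?thesis
  proof (rule that[OF \<delta>])
    fix n and G :: "nat ugraph"
    assume n: "n \<ge> n\<^sub>0" and G: "nvertex_graph n G" and "free_of F G"
      and "real (num_copies H G) \<ge> real (ex n H F) - \<delta> * real n ^ card (verts H)"
    then obtain T where T: "complete_multipartite (chromatic_number F - 1) T" "verts T = verts G"
      "real (edit_distance G T) \<le> \<epsilon> * real n ^ 2" using stab by blast
    obtain p where p: "T = partite_graph (verts G) p" "p ` verts G = {..<chromatic_number F - 1}"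
      using complete_multipartiteE[OF T(1)] T(2) by metis
    have "finite (edges G)" "finite (edges T)"
      using G T(1) by (auto simp: nvertex_graph_def complete_multipartite_def intro: finite_edges)
    from edit_distance_ge[OF this] T(3) p
    show "\<exists>p. p ` verts G = {..<chromatic_number F - 1} \<and>
         real (card (edges G - edges (partite_graph (verts G) p)) +
               card (edges (partite_graph (verts G) p) - edges G)) \<le> \<epsilon> * real n ^ 2"
      by (intro exI[of _ p]) auto
  qed
qed

text \<open>The source of contradictions with stability. Complete adjacency between \<open>A\<close>
  and \<open>B\<close> and none from either to \<open>C\<close>, all of linear size, keeps a graph
  quadratically far from every complete multipartite graph, whatever the number of parts; so no
  near-extremal graph may contain this pattern.\<close>

lemma weakly_Turan_stable_no_pattern:
  fixes F :: "'b ugraph" and H :: "'a ugraph"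
  assumes "weakly_Turan_stable F H" and \<alpha>: "\<alpha> > 0"
  obtains \<delta> :: real and n\<^sub>0 :: nat where "\<delta> > 0"
    "\<And>n (G :: nat ugraph) A B C m. n \<ge> n\<^sub>0 \<Longrightarrow> nvertex_graph n G \<Longrightarrow> free_of F G \<Longrightarrow>
       real (num_copies H G) \<ge> real (ex n H F) - \<delta> * real n ^ card (verts H) \<Longrightarrow>
       A \<subseteq> verts G \<Longrightarrow> B \<subseteq> verts G \<Longrightarrow> C \<subseteq> verts G \<Longrightarrow>
       A \<inter> B = {} \<Longrightarrow> A \<inter> C = {} \<Longrightarrow> B \<inter> C = {} \<Longrightarrow>
       card A = m \<Longrightarrow> card B = m \<Longrightarrow> card C = m \<Longrightarrow> \<alpha> * real n \<le> real m \<Longrightarrow>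
       (\<And>a b. a \<in> A \<Longrightarrow> b \<in> B \<Longrightarrow> {a, b} \<in> edges G) \<Longrightarrow>
       (\<And>a c. a \<in> A \<Longrightarrow> c \<in> C \<Longrightarrow> {a, c} \<notin> edges G) \<Longrightarrow>
       (\<And>b c. b \<in> B \<Longrightarrow> c \<in> C \<Longrightarrow> {b, c} \<notin> edges G) \<Longrightarrow> False"
proof -
  \<comment> \<open>By \<open>far_from_partite\<close> the pattern forces at least m^3 / n \<ge>
    \<alpha>^3 n^2 edits; half of that contradicts stability.\<close>
  define \<epsilon> where "\<epsilon> = \<alpha> ^ 3 / 2"
  have "\<epsilon> > 0" using \<alpha> by (simp add: \<epsilon>_def)
  obtain \<delta> :: real and n\<^sub>0 :: nat where \<delta>: "\<delta> > 0"
    and stab: "\<And>n (G :: nat ugraph). n \<ge> n\<^sub>0 \<Longrightarrow> nvertex_graph n G \<Longrightarrow> free_of F G \<Longrightarrow>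
       real (num_copies H G) \<ge> real (ex n H F) - \<delta> * real n ^ card (verts H) \<Longrightarrow>
       \<exists>p. p ` verts G = {..<chromatic_number F - 1} \<and>
         real (card (edges G - edges (partite_graph (verts G) p)) +
               card (edges (partite_graph (verts G) p) - edges G)) \<le> \<epsilon> * real n ^ 2"
    using weakly_Turan_stable_structure[OF assms(1) \<open>\<epsilon> > 0\<close>] by blast
  show ?thesis
  proof (rule that[OF \<delta>, of "max 1 n\<^sub>0"])
    fix n and G :: "nat ugraph" and A B C m
    assume n: "n \<ge> max 1 n\<^sub>0" and G: "nvertex_graph n G" "free_of F G"
      "real (num_copies H G) \<ge> real (ex n H F) - \<delta> * real n ^ card (verts H)"
      and ABC: "A \<subseteq> verts G" "B \<subseteq> verts G" "C \<subseteq> verts G" "A \<inter> B = {}" "A \<inter> C = {}" "B \<inter> C = {}"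
        "card A = m" "card B = m" "card C = m"
      and m: "\<alpha> * real n \<le> real m"
      and adj: "\<And>a b. a \<in> A \<Longrightarrow> b \<in> B \<Longrightarrow> {a, b} \<in> edges G"
       "\<And>a c. a \<in> A \<Longrightarrow> c \<in> C \<Longrightarrow> {a, c} \<notin> edges G"
       "\<And>b c. b \<in> B \<Longrightarrow> c \<in> C \<Longrightarrow> {b, c} \<notin> edges G"
    obtain p where p: "real (card (edges G - edges (partite_graph (verts G) p)) +
               card (edges (partite_graph (verts G) p) - edges G)) \<le> \<epsilon> * real n ^ 2" (is "real ?d \<le> _")
      using stab[OF _ G] n by auto
    have simple: "finite_simple_graph G" and cV: "card (verts G) = n"
      using G(1) by (auto simp: nvertex_graph_def)
    have "m ^ 3 \<le> ?d * n"
      using far_from_partite[OF simple ABC adj, of p] by (simp only: cV)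
    then have "real m ^ 3 \<le> real ?d * real n" by (metis of_nat_le_iff of_nat_mult of_nat_power)
    also have "\<dots> \<le> (\<epsilon> * real n ^ 2) * real n" using p by (intro mult_right_mono) auto
    also have "\<dots> = (\<alpha> * real n) ^ 3 / 2" by (simp add: \<epsilon>_def power_mult_distrib power2_eq_square power3_eq_cube)
    also have "\<dots> < (\<alpha> * real n) ^ 3" using \<alpha> n by simp
    also have "\<dots> \<le> real m ^ 3" using m \<alpha> by (intro power_mono) auto
    finally show False by simp
  qed
qed

text \<open>If \<open>H\<close> were edgeless, all graphs on n vertices would have equally many
  copies, so every \<open>F\<close>-free graph would be extremal. One of them is a complete
  bipartite graph on two thirds of the vertices, bipartite and hence \<open>F\<close>-free as
  \<chi>(F) > 2, which contains the forbidden pattern.\<close>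

lemma weakly_Turan_stable_imp_edges:
  fixes F :: "'b ugraph" and H :: "'a ugraph"
  assumes H: "finite_simple_graph H" and F: "finite_simple_graph F" and edgesF: "edges F \<noteq> {}"
    and stab: "weakly_Turan_stable F H" and k: "2 < chromatic_number F"
  shows "edges H \<noteq> {}"
proof
  assume edgesH: "edges H = {}"
  have "(1 / 6 :: real) > 0" by simp
  then obtain \<delta> :: real and n\<^sub>0 :: nat where \<delta>: "\<delta> > 0" and no_pattern:
    "\<And>n (G :: nat ugraph) A B C m. n \<ge> n\<^sub>0 \<Longrightarrow> nvertex_graph n G \<Longrightarrow> free_of F G \<Longrightarrow>
       real (num_copies H G) \<ge> real (ex n H F) - \<delta> * real n ^ card (verts H) \<Longrightarrow>
       A \<subseteq> verts G \<Longrightarrow> B \<subseteq> verts G \<Longrightarrow> C \<subseteq> verts G \<Longrightarrow>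
       A \<inter> B = {} \<Longrightarrow> A \<inter> C = {} \<Longrightarrow> B \<inter> C = {} \<Longrightarrow>
       card A = m \<Longrightarrow> card B = m \<Longrightarrow> card C = m \<Longrightarrow> 1/6 * real n \<le> real m \<Longrightarrow>
       (\<And>a b. a \<in> A \<Longrightarrow> b \<in> B \<Longrightarrow> {a, b} \<in> edges G) \<Longrightarrow>
       (\<And>a c. a \<in> A \<Longrightarrow> c \<in> C \<Longrightarrow> {a, c} \<notin> edges G) \<Longrightarrow>
       (\<And>b c. b \<in> B \<Longrightarrow> c \<in> C \<Longrightarrow> {b, c} \<notin> edges G) \<Longrightarrow> False"
    using weakly_Turan_stable_no_pattern[OF stab] by blast
  define n where "n = 3 * Suc n\<^sub>0"
  define m where "m = Suc n\<^sub>0"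
  obtain G\<^sub>0 :: "nat ugraph" where G\<^sub>0: "nvertex_graph n G\<^sub>0" "free_of F G\<^sub>0" "ex n H F = num_copies H G\<^sub>0"
    using ex_attained[OF H F edgesF] .
  define V where "V = verts G\<^sub>0"
  have V: "finite V" "card V = n" using G\<^sub>0(1) by (auto simp: V_def nvertex_graph_def finite_simple_graph_def)
  have "3 * m \<le> card V" by (simp add: V n_def m_def)
  from obtain_three_disjoint_subsets[OF this] obtain A B C
    where ABC: "A \<subseteq> V" "B \<subseteq> V" "C \<subseteq> V" "A \<inter> B = {}" "A \<inter> C = {}" "B \<inter> C = {}"
      "card A = m" "card B = m" "card C = m" .
  define G where "G = (V, {{a, b} | a b. a \<in> A \<and> b \<in> B})"
  have vG: "verts G = V" by (simp add: G_def)
  have edG: "{u, v} \<in> edges G \<longleftrightarrow> u \<in> A \<and> v \<in> B \<or> v \<in> A \<and> u \<in> B" for u v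
    by (auto simp: G_def doubleton_eq_iff)
  have "finite_simple_graph G"
    using V(1) ABC(1,2,4) by (auto simp: finite_simple_graph_def G_def card_2_iff) blast
  then have nG: "nvertex_graph n G" by (simp add: nvertex_graph_def vG V)
  have "colorable 2 G"
    unfolding colorable_def using ABC(4)
    by (intro exI[of _ "\<lambda>x. if x \<in> A then 0 else 1"]) (auto simp: edG)
  then have free: "free_of F G" using colorable_free_of[OF F] k by blast
  have "num_copies H G = ex n H F"
    unfolding G\<^sub>0(3) by (rule num_copies_edgeless[OF edgesH]) (simp add: vG V_def)
  then have many: "real (num_copies H G) \<ge> real (ex n H F) - \<delta> * real n ^ card (verts H)"
    using \<delta> by simp
  have "n \<ge> n\<^sub>0" "1/6 * real n \<le> real m" by (auto simp: n_def m_def)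
  from no_pattern[OF this(1) nG free many ABC[folded vG] this(2)] show False
    using ABC(4,5,6) by (auto simp: edG)
qed

lemma exists_large_part:
  assumes "finite V" "p ` V \<subseteq> {..<k}" "k > 0"
  obtains j where "j < k" "card V \<le> k * card {x \<in> V. p x = j}"
proof -
  have "\<exists>j<k. card V \<le> k * card {x \<in> V. p x = j}"
  proof (rule ccontr)
    assume "\<not> ?thesis"
    then have less: "k * card {x \<in> V. p x = j} < card V" if "j < k" for j using that by auto
    have "V = (\<Union>j<k. {x \<in> V. p x = j})" using assms(2) by auto
    then have "card V \<le> (\<Sum>j<k. card {x \<in> V. p x = j})"
      using card_UN_le[of "{..<k}" "\<lambda>j. {x \<in> V. p x = j}"] by simp
    then have "k * card V \<le> (\<Sum>j<k. k * card {x \<in> V. p x = j})"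
      unfolding sum_distrib_left[symmetric] by (rule mult_le_mono2)
    also have "\<dots> < (\<Sum>j<k. card V)" using less assms(3) by (intro sum_strict_mono) auto
    finally show False by simp
  qed
  then show ?thesis using that by blast
qed

text \<open>If a part were small, one could delete it and plant a complete bipartite graph on two thirds
  of the largest part; this loses few copies of \<open>H\<close>, contradicting stability.\<close>

lemma weakly_Turan_stable_large_parts:
  fixes F :: "'b ugraph" and H :: "'a ugraph"
  defines "k \<equiv> chromatic_number F - 1"
  assumes H: "finite_simple_graph H" and F: "finite_simple_graph F" and edgesF: "edges F \<noteq> {}"
    and stab: "weakly_Turan_stable F H" and k: "2 < chromatic_number F"
  obtains \<delta> :: real and n\<^sub>0 :: nat where "\<delta> > 0"
    "\<And>n (G :: nat ugraph) p i. n \<ge> n\<^sub>0 \<Longrightarrow> nvertex_graph n G \<Longrightarrow> free_of F G \<Longrightarrow>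
       real (num_copies H G) \<ge> real (ex n H F) - \<delta> * real n ^ card (verts H) \<Longrightarrow>
       p ` verts G \<subseteq> {..<k} \<Longrightarrow>
       real (card (edges G - edges (partite_graph (verts G) p))) \<le> \<delta> * real n ^ 2 \<Longrightarrow>
       i < k \<Longrightarrow> \<delta> * real n \<le> real (card {x \<in> verts G. p x = i})"
proof -
  have k2: "k \<ge> 2" using k by (simp add: k_def)
  \<comment> \<open>The largest part has at least n / k vertices. It is cut into pieces of
    \<open>n div (3 * k)\<close> vertices, which is at least n / (6k) once n \<ge> 3k.\<close>
  define \<alpha> :: real where "\<alpha> = 1 / (6 * real k)"
  have \<alpha>: "\<alpha> > 0" using k2 by (simp add: \<alpha>_def)
  define h where "h = card (verts H)"
  obtain \<delta> :: real and n\<^sub>0 :: nat where \<delta>: "\<delta> > 0" and no_pattern: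
    "\<And>n (G :: nat ugraph) A B C m. n \<ge> n\<^sub>0 \<Longrightarrow> nvertex_graph n G \<Longrightarrow> free_of F G \<Longrightarrow>
       real (num_copies H G) \<ge> real (ex n H F) - \<delta> * real n ^ card (verts H) \<Longrightarrow>
       A \<subseteq> verts G \<Longrightarrow> B \<subseteq> verts G \<Longrightarrow> C \<subseteq> verts G \<Longrightarrow>
       A \<inter> B = {} \<Longrightarrow> A \<inter> C = {} \<Longrightarrow> B \<inter> C = {} \<Longrightarrow>
       card A = m \<Longrightarrow> card B = m \<Longrightarrow> card C = m \<Longrightarrow> \<alpha> * real n \<le> real m \<Longrightarrow>
       (\<And>a b. a \<in> A \<Longrightarrow> b \<in> B \<Longrightarrow> {a, b} \<in> edges G) \<Longrightarrow>
       (\<And>a c. a \<in> A \<Longrightarrow> c \<in> C \<Longrightarrow> {a, c} \<notin> edges G) \<Longrightarrow>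
       (\<And>b c. b \<in> B \<Longrightarrow> c \<in> C \<Longrightarrow> {b, c} \<notin> edges G) \<Longrightarrow> False"
    using weakly_Turan_stable_no_pattern[OF stab \<alpha>] by blast
  obtain e where "e \<in> edges H"
    using weakly_Turan_stable_imp_edges[OF H F edgesF stab k] by blast
  then have "card e = 2" "e \<subseteq> verts H" "finite (verts H)" using H by (auto simp: finite_simple_graph_def)
  then have h2: "h \<ge> 2" unfolding h_def by (metis card_mono)
  define K where "K = real (h ^ 2)"
  have K: "K \<ge> 0" by (simp add: K_def)
  \<comment> \<open>The first bound keeps a small part distinct from the largest one. The second
    keeps the total deficit below \<delta> n^h: 2 K \<eta> n^h copies are lost by deletion and
    \<eta> n^h is the deficit already allowed to \<open>G\<close>.\<close>
  define \<eta> where "\<eta> = min (1 / real k) (\<delta> / (2 * K + 1))"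
  have \<eta>: "\<eta> > 0" using \<delta> k2 K by (simp add: \<eta>_def)
  have "\<eta> * (2 * K + 1) \<le> \<delta>"
  proof -
    have "\<eta> \<le> \<delta> / (2 * K + 1)" by (simp add: \<eta>_def)
    then show ?thesis using K by (simp add: pos_le_divide_eq)
  qed
  show ?thesis
  proof (rule that[OF \<eta>, of "max n\<^sub>0 (3 * k)"], rule ccontr)
    fix n and G :: "nat ugraph" and p i
    assume n: "n \<ge> max n\<^sub>0 (3 * k)" and nG: "nvertex_graph n G" and "free_of F G"
      and many: "real (num_copies H G) \<ge> real (ex n H F) - \<eta> * real n ^ card (verts H)"
      and p: "p ` verts G \<subseteq> {..<k}"
      and close: "real (card (edges G - edges (partite_graph (verts G) p))) \<le> \<eta> * real n ^ 2"
      and i: "i < k" and small: "\<not> \<eta> * real n \<le> real (card {x \<in> verts G. p x = i})"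
    let ?V = "\<lambda>i. {x \<in> verts G. p x = i}"
    let ?T = "partite_graph (verts G) p"
    have G: "finite_simple_graph G" "card (verts G) = n" using nG by (auto simp: nvertex_graph_def)
    have finV: "finite (verts G)" using G by (simp add: finite_simple_graph_def)
    obtain j where j: "j < k" "n \<le> k * card (?V j)"
      using exists_large_part[OF finV p] k2 G(2) by auto
    have "i \<noteq> j"
    proof
      assume "i = j"
      then have "real n \<le> real k * card (?V i)" using j(2) by (metis of_nat_le_iff of_nat_mult)
      moreover have "\<eta> * real n \<le> 1 / real k * real n" by (intro mult_right_mono) (auto simp: \<eta>_def)
      moreover have "1 / real k * real n \<le> real (card (?V i)) \<longleftrightarrow> real n \<le> real k * card (?V i)"
        using k2 by (simp add: divide_le_eq mult.commute)
      ultimately have "\<eta> * real n \<le> card (?V i)" by linarith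
      then show False using small by simp
    qed
    define m where "m = n div (3 * k)"
    have "m * (3 * k) \<le> n" unfolding m_def by (rule div_times_less_eq_dividend)
    also have "m * (3 * k) = k * (3 * m)" by simp
    also note j(2)
    finally have "3 * m \<le> card (?V j)" using k2 by simp
    from obtain_three_disjoint_subsets[OF this] obtain A B C
      where ABC: "A \<subseteq> ?V j" "B \<subseteq> ?V j" "C \<subseteq> ?V j" "A \<inter> B = {}" "A \<inter> C = {}" "B \<inter> C = {}"
        "card A = m" "card B = m" "card C = m" .
    have m: "\<alpha> * real n \<le> real m"
    proof -
      have "m \<ge> 1" using n k2 by (simp add: m_def div_greater_zero_iff Suc_le_eq)
      have "n < 3 * k + m * (3 * k)" unfolding m_def using k2 by (intro dividend_less_div_times) simp
      also have "\<dots> \<le> m * (3 * k) + m * (3 * k)" using \<open>m \<ge> 1\<close> by simp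
      finally have "n \<le> 6 * k * m" by (simp add: ac_simps)
      then have "real n \<le> real (6 * k * m)" by (rule of_nat_mono)
      then show ?thesis using k2 by (simp add: \<alpha>_def field_simps)
    qed
    define G' where "G' = (verts G, {e \<in> edges ?T. e \<inter> ?V i = {}} \<union> {{a, b} | a b. a \<in> A \<and> b \<in> B})"
    have vG': "verts G' = verts G" by (simp add: G'_def)
    have edG': "{u, v} \<in> edges G' \<longleftrightarrow>
        (u \<in> verts G \<and> v \<in> verts G \<and> p u \<noteq> p v \<and> p u \<noteq> i \<and> p v \<noteq> i) \<or>
        u \<in> A \<and> v \<in> B \<or> v \<in> A \<and> u \<in> B" for u v
      by (auto simp: G'_def doubleton_eq_iff)
    have simple: "finite_simple_graph G'"
      unfolding finite_simple_graph_def
    proof (intro conjI ballI)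
      fix e assume e: "e \<in> edges G'"
      consider "e \<in> edges ?T" | a b where "e = {a, b}" "a \<in> A" "b \<in> B"
        using e by (auto simp: G'_def)
      then show "e \<subseteq> verts G'" "card e = 2"
      proof (atomize (full), cases)
        case 1
        then show "e \<subseteq> verts G' \<and> card e = 2"
          using finite_simple_partite_graph[OF finV, of p] by (simp add: vG' finite_simple_graph_def)
      next
        case 2
        then have "a \<noteq> b" "a \<in> verts G" "b \<in> verts G" using ABC(1,2,4) by auto
        then show "e \<subseteq> verts G' \<and> card e = 2" using 2 by (simp add: vG')
      qed
    qed (simp add: vG' finV)
    then have nG': "nvertex_graph n G'" by (simp add: nvertex_graph_def vG' G)
    \<comment> \<open>No edge of \<open>G'\<close> meets part \<open>i\<close>, so colour
      \<open>i\<close> is free and can be given to \<open>B\<close>, which separates it from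
      \<open>A\<close>.\<close>
    have "colorable k G'"
      unfolding colorable_def
    proof (intro exI[of _ "\<lambda>x. if x \<in> B then i else p x"] conjI allI impI)
      show "(\<lambda>x. if x \<in> B then i else p x) ` verts G' \<subseteq> {..<k}" using p i by (auto simp: vG')
      fix u v assume "{u, v} \<in> edges G'"
      then show "(if u \<in> B then i else p u) \<noteq> (if v \<in> B then i else p v)"
        using ABC(1,2,4) \<open>i \<noteq> j\<close> by (auto simp: edG')
    qed
    then have free: "free_of F G'"
      by (rule colorable_free_of[OF F]) (use k in \<open>simp add: k_def\<close>)
    \<comment> \<open>A lost edge is an inner edge of \<open>G\<close> or meets the small part;
      either kind accounts for at most \<eta> n^2 edges.\<close>
    have lost: "edges G - edges G' \<subseteq> (edges G - edges ?T) \<union> (\<lambda>(x, y). {x, y}) ` (?V i \<times> verts G)"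
    proof
      fix e assume e: "e \<in> edges G - edges G'"
      then obtain u v where uv: "e = {u, v}" "u \<in> verts G" "v \<in> verts G"
        using edgeE[OF G(1)] by (metis Diff_iff)
      show "e \<in> (edges G - edges ?T) \<union> (\<lambda>(x, y). {x, y}) ` (?V i \<times> verts G)"
      proof (cases "e \<in> edges ?T")
        case True
        then have "p u \<noteq> p v" using uv by simp
        then have "p u = i \<or> p v = i" using e uv edG'[of u v] by auto
        then have "(u, v) \<in> ?V i \<times> verts G \<or> (v, u) \<in> ?V i \<times> verts G" using uv by auto
        moreover have "e = (\<lambda>(x, y). {x, y}) (u, v)" "e = (\<lambda>(x, y). {x, y}) (v, u)"
          using uv(1) by auto
        ultimately have "e \<in> (\<lambda>(x, y). {x, y}) ` (?V i \<times> verts G)" by (elim disjE) (rule image_eqI; assumption)+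
        then show ?thesis by (rule UnI2)
      qed (use e in blast)
    qed
    have "card (edges G - edges G') \<le> card (edges G - edges ?T) + card (?V i) * n"
    proof -
      have "card (edges G - edges G') \<le>
          card ((edges G - edges ?T) \<union> (\<lambda>(x, y). {x, y}) ` (?V i \<times> verts G))"
        using finV finite_edges[OF G(1)] by (intro card_mono[OF _ lost]) auto
      also have "\<dots> \<le> card (edges G - edges ?T) + card ((\<lambda>(x, y). {x, y}) ` (?V i \<times> verts G))"
        by (rule card_Un_le)
      also have "card ((\<lambda>(x, y). {x, y}) ` (?V i \<times> verts G)) \<le> card (?V i \<times> verts G)"
        using finV by (intro card_image_le) auto
      finally show ?thesis using G by (simp add: card_cartesian_product)
    qed
    from of_nat_mono[OF this, where ?'a = real] have "real (card (edges G - edges G')) \<le>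
        real (card (edges G - edges ?T)) + real (card (?V i)) * real n"
      by simp
    also have "\<dots> \<le> \<eta> * real n ^ 2 + (\<eta> * real n) * real n"
      using close small by (intro add_mono mult_right_mono) auto
    finally have diff: "real (card (edges G - edges G')) \<le> 2 * \<eta> * real n ^ 2"
      by (simp add: power2_eq_square)
    have "num_copies H G \<le> num_copies H G' + card (edges G - edges G') * (h ^ 2 * n ^ (h - 2))"
      using num_copies_le_add_diff[OF H G(1), of G'] by (simp add: vG' G(2) h_def)
    from of_nat_mono[OF this, where ?'a = real] have "real (num_copies H G) \<le> real (num_copies H G') +
        real (card (edges G - edges G')) * (K * real n ^ (h - 2))"
      by (simp add: K_def)
    also have "\<dots> \<le> real (num_copies H G') + 2 * \<eta> * real n ^ 2 * (K * real n ^ (h - 2))"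
      using diff K by (intro add_left_mono mult_right_mono) auto
    also have "2 * \<eta> * real n ^ 2 * (K * real n ^ (h - 2)) = 2 * \<eta> * K * real n ^ h"
    proof -
      have "real n ^ h = real n ^ 2 * real n ^ (h - 2)" using h2 by (metis le_add_diff_inverse power_add)
      then show ?thesis by simp
    qed
    finally have "real (ex n H F) - (2 * \<eta> * K * real n ^ h + \<eta> * real n ^ h) \<le> real (num_copies H G')"
      using many by (simp add: h_def)
    moreover have "2 * \<eta> * K * real n ^ h + \<eta> * real n ^ h = \<eta> * (2 * K + 1) * real n ^ h"
      by (simp add: algebra_simps)
    moreover have "\<eta> * (2 * K + 1) * real n ^ h \<le> \<delta> * real n ^ h"
      using \<open>\<eta> * (2 * K + 1) \<le> \<delta>\<close> by (intro mult_right_mono) auto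
    ultimately have many': "real (num_copies H G') \<ge> real (ex n H F) - \<delta> * real n ^ card (verts H)"
      by (simp add: h_def)
    have sub: "A \<subseteq> verts G'" "B \<subseteq> verts G'" "C \<subseteq> verts G'" using ABC(1-3) vG' by auto
    have "n \<ge> n\<^sub>0" using n by simp
    moreover have "{a, b} \<in> edges G'" if "a \<in> A" "b \<in> B" for a b using that by (simp add: edG')
    moreover have "{a, c} \<notin> edges G'" if "a \<in> A \<union> B" "c \<in> C" for a c
    proof -
      have "p a = j" "p c = j" "c \<notin> A" "c \<notin> B" using that ABC by auto
      then show ?thesis by (simp add: edG')
    qed
    ultimately show False
      using no_pattern[OF _ nG' free many' sub ABC(4-9) m] by blast
  qed
qed

section \<open>Using the critical edge\<close>

lemma card_ordered_pairs_le:
  assumes "finite M"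
  shows "finite {(a, b). {a, b} \<in> M}" "card {(a, b). {a, b} \<in> M} \<le> 2 * card M"
proof -
  have one: "finite {(a, b). {a, b} = e} \<and> card {(a, b). {a, b} = e} \<le> 2" for e :: "'a set"
  proof (cases "\<exists>x y. e = {x, y}")
    case True
    then obtain x y where "e = {x, y}" by blast
    then have sub: "{(a, b). {a, b} = e} \<subseteq> {(x, y), (y, x)}" by (auto simp: doubleton_eq_iff)
    have "card {(x, y), (y, x)} \<le> 2" by (cases "x = y") simp_all
    have fin: "finite {(x, y), (y, x)}" by simp
    show ?thesis using card_mono[OF fin sub] finite_subset[OF sub fin] \<open>card {(x, y), (y, x)} \<le> 2\<close> by linarith
  next
    case False
    then have "{(a, b). {a, b} = e} = {}" by blast
    then show ?thesis by (metis card.empty finite.emptyI le0)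
  qed
  have eq: "{(a, b). {a, b} \<in> M} = (\<Union>e\<in>M. {(a, b). {a, b} = e})" by auto
  show "finite {(a, b). {a, b} \<in> M}" unfolding eq using one assms by blast
  have "card {(a, b). {a, b} \<in> M} \<le> (\<Sum>e\<in>M. card {(a, b). {a, b} = e})"
    unfolding eq by (rule card_UN_le[OF assms])
  also have "\<dots> \<le> 2 * card M"
    using sum_bounded_above[of M "\<lambda>e. card {(a, b). {a, b} = e}" 2] one by simp
  finally show "card {(a, b). {a, b} \<in> M} \<le> 2 * card M" .
qed

text \<open>For vertices of the same colour the forbidden pairs are the diagonal, for different
  colours the missing cross pairs. Both are few compared with \<open>s ^ 2\<close>, so
  \<open>card_PiE_avoiding\<close> leaves a choice. Different colours need no diagonal, since their
  images lie in different parts.\<close>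

lemma exists_crossing_choice:
  fixes col :: "'b \<Rightarrow> nat"
  assumes G: "finite_simple_graph G" and Q: "finite Q"
    and U: "\<And>q. q \<in> Q \<Longrightarrow> U q \<subseteq> {x \<in> verts G. p x = col q}" "\<And>q. q \<in> Q \<Longrightarrow> s \<le> card (U q)"
    and s: "s > 0" "2 * card Q ^ 2 *
      (2 * card (edges (partite_graph (verts G) p) - edges G) + card (verts G)) \<le> s ^ 2"
  obtains g where "\<And>q. q \<in> Q \<Longrightarrow> g q \<in> U q" "inj_on g Q"
    "\<And>q q'. q \<in> Q \<Longrightarrow> q' \<in> Q \<Longrightarrow> col q \<noteq> col q' \<Longrightarrow> {g q, g q'} \<in> edges G"
proof -
  define M where "M = edges (partite_graph (verts G) p) - edges G"
  have finV: "finite (verts G)" using G by (simp add: finite_simple_graph_def)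
  have finM: "finite M"
    using finite_edges[OF finite_simple_partite_graph[OF finV]] by (simp add: M_def)
  have "\<forall>q\<in>Q. \<exists>W. W \<subseteq> U q \<and> finite W \<and> card W = s"
    using U(2) by (metis obtain_subset_with_card_n)
  then obtain W where W: "\<And>q. q \<in> Q \<Longrightarrow> W q \<subseteq> U q \<and> finite (W q) \<and> card (W q) = s"
    by (auto dest!: bchoice)
  define R where "R = (\<lambda>q q'. if col q = col q' then (\<lambda>x. (x, x)) ` verts G else {(a, b). {a, b} \<in> M})"
  have "card ((\<lambda>x. (x, x)) ` verts G) \<le> card (verts G)" using finV by (rule card_image_le)
  then have R: "finite (R q q') \<and> card (R q q') \<le> 2 * card M + card (verts G)" for q q'
    using card_ordered_pairs_le[OF finM] finV by (simp add: R_def)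
  have "s ^ card Q \<le> 2 * card {g \<in> Pi\<^sub>E Q W. \<forall>q\<in>Q. \<forall>q'\<in>Q. q \<noteq> q' \<longrightarrow> (g q, g q') \<notin> R q q'}"
    using W s(2) by (intro card_PiE_avoiding[OF Q _ R]) (auto simp: M_def)
  moreover have "s ^ card Q > 0" using s(1) by simp
  ultimately have "{g \<in> Pi\<^sub>E Q W. \<forall>q\<in>Q. \<forall>q'\<in>Q. q \<noteq> q' \<longrightarrow> (g q, g q') \<notin> R q q'} \<noteq> {}"
    by (metis card.empty mult_0_right not_le)
  then obtain g where g: "g \<in> Pi\<^sub>E Q W" "\<And>q q'. q \<in> Q \<Longrightarrow> q' \<in> Q \<Longrightarrow> q \<noteq> q' \<Longrightarrow> (g q, g q') \<notin> R q q'"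
    by blast
  have gU: "g q \<in> U q" if "q \<in> Q" for q using g(1) W[OF that] that by (auto simp: PiE_iff)
  have gp: "g q \<in> verts G" "p (g q) = col q" if "q \<in> Q" for q using gU[OF that] U(1)[OF that] by auto
  show ?thesis
  proof (rule that[of g])
    show "inj_on g Q"
    proof (rule inj_onI, rule ccontr)
      fix q q' assume q: "q \<in> Q" "q' \<in> Q" "g q = g q'" "q \<noteq> q'"
      then have "col q = col q'" using gp by metis
      then show False using g(2)[OF q(1,2,4)] q gp by (auto simp: R_def)
    qed
    fix q q' assume q: "q \<in> Q" "q' \<in> Q" "col q \<noteq> col q'"
    then have "{g q, g q'} \<notin> M" using g(2)[of q q'] by (auto simp: R_def)
    then show "{g q, g q'} \<in> edges G" using q gp by (simp add: M_def)
  qed (rule gU)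
qed

text \<open>Without \<open>e\<close> the graph has a colouring with \<chi>(F) - 1 colours, and the
  endpoints of \<open>e\<close> must share a colour, since otherwise it would colour
  \<open>F\<close>. Swapping two colours then gives both endpoints any prescribed colour
  \<open>i\<close>.\<close>

lemma color_critical_edge_coloring:
  assumes F: "finite_simple_graph F" and crit: "color_critical_edge F e"
    and i: "i < chromatic_number F - 1"
  obtains u v col where "e = {u, v}" "u \<noteq> v" "u \<in> verts F" "v \<in> verts F"
    "col ` verts F \<subseteq> {..<chromatic_number F - 1}" "col u = i" "col v = i"
    "\<And>a b. {a, b} \<in> edges F \<Longrightarrow> {a, b} \<noteq> e \<Longrightarrow> col a \<noteq> col b"
proof -
  define k where "k = chromatic_number F - 1"
  have e: "e \<in> edges F" using crit by (simp add: color_critical_edge_def)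
  obtain u v where uv: "e = {u, v}" "u \<noteq> v" "u \<in> verts F" "v \<in> verts F" using edgeE[OF F e] by metis
  define F' where "F' = (verts F, edges F - {e})"
  have "finite_simple_graph F'" using F by (auto simp: finite_simple_graph_def F'_def)
  then have "colorable (chromatic_number F') F'" by (rule colorable_chromatic_number)
  moreover have "chromatic_number F' \<le> k"
    using crit unfolding color_critical_edge_def F'_def k_def by linarith
  ultimately have "colorable k F'" by (rule colorable_mono)
  then obtain c :: "'a \<Rightarrow> nat" where c: "c ` verts F \<subseteq> {..<k}"
    "\<And>a b. {a, b} \<in> edges F - {e} \<Longrightarrow> c a \<noteq> c b"
    by (auto simp: colorable_def F'_def)
  have "c u = c v"
  proof (rule ccontr)
    assume neq: "c u \<noteq> c v"
    have "c a \<noteq> c b" if "{a, b} \<in> edges F" for a b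
      using c(2)[of a b] that neq uv(1) by (cases "{a, b} = e") (auto simp: doubleton_eq_iff)
    then have "colorable k F" using c(1) by (auto simp: colorable_def)
    then have "chromatic_number F \<le> k" by (rule chromatic_number_le)
    then show False using i by (simp add: k_def)
  qed
  define col where "col = (\<lambda>w. if c w = c u then i else if c w = i then c u else c w)"
  have iff: "col a = col b \<longleftrightarrow> c a = c b" for a b by (auto simp: col_def)
  show ?thesis
  proof (rule that[OF uv, of col])
    have "i < k" "c u < k" using i c(1) uv(3) by (auto simp: k_def)
    then show "col ` verts F \<subseteq> {..<chromatic_number F - 1}"
      using c(1) unfolding k_def[symmetric] col_def by auto
    show "col u = i" "col v = i" using \<open>c u = c v\<close> by (auto simp: col_def)
  qed (use c(2) iff in auto)
qed

text \<open>An embedding of \<open>F\<close> with one endpoint of the critical edge at \<open>x\<close>.\<close>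

lemma color_critical_not_free_star:
  assumes F: "finite_simple_graph F" and crit: "color_critical_edge F e"
    and k: "1 < chromatic_number F"
    and G: "finite_simple_graph G" and x: "x \<in> verts G"
    and nb: "\<And>j. j < chromatic_number F - 1 \<Longrightarrow> s \<le> card {y \<in> verts G. p y = j \<and> {x, y} \<in> edges G}"
    and s: "s > 0" "2 * card (verts F) ^ 2 *
      (2 * card (edges (partite_graph (verts G) p) - edges G) + card (verts G)) \<le> s ^ 2"
  shows "\<not> free_of F G"
proof -
  \<comment> \<open>Any colour would do in place of 0: \<open>x\<close> has many neighbours in every
    part, so \<open>u\<close> can be placed there whatever the part of \<open>x\<close>, and the
    other vertices are chosen among neighbours of \<open>x\<close>.\<close>
  obtain u v col where uv: "e = {u, v}" "u \<noteq> v" "u \<in> verts F" "v \<in> verts F"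
    and col: "col ` verts F \<subseteq> {..<chromatic_number F - 1}"
      "\<And>a b. {a, b} \<in> edges F \<Longrightarrow> {a, b} \<noteq> e \<Longrightarrow> col a \<noteq> col b"
    using color_critical_edge_coloring[OF F crit, of 0] k by (metis zero_less_diff)
  have finF: "finite (verts F)" using F by (simp add: finite_simple_graph_def)
  define Q where "Q = verts F - {u}"
  have "card Q \<le> card (verts F)" using finF by (auto simp: Q_def intro: card_mono)
  then have "2 * card Q ^ 2 * (2 * card (edges (partite_graph (verts G) p) - edges G) + card (verts G))
      \<le> 2 * card (verts F) ^ 2 * (2 * card (edges (partite_graph (verts G) p) - edges G) + card (verts G))"
    by (intro mult_le_mono1 mult_le_mono2 power_mono) auto
  also note s(2)
  finally have sQ: "2 * card Q ^ 2 *
    (2 * card (edges (partite_graph (verts G) p) - edges G) + card (verts G)) \<le> s ^ 2" .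
  have "finite Q" using finF by (simp add: Q_def)
  then obtain g where g: "\<And>q. q \<in> Q \<Longrightarrow> g q \<in> {y \<in> verts G. p y = col q \<and> {x, y} \<in> edges G}"
    "inj_on g Q" "\<And>q q'. q \<in> Q \<Longrightarrow> q' \<in> Q \<Longrightarrow> col q \<noteq> col q' \<Longrightarrow> {g q, g q'} \<in> edges G"
    using exists_crossing_choice[OF G, of Q "\<lambda>q. {y \<in> verts G. p y = col q \<and> {x, y} \<in> edges G}" p col s]
      nb col(1) s(1) sQ by (auto simp: Q_def image_subset_iff)
  define f where "f = (\<lambda>w\<in>verts F. if w = u then x else g w)"
  have gx: "g q \<noteq> x" if "q \<in> Q" for q using g(1)[OF that] edge_doubletonD(1)[OF G, of x "g q"] by auto
  have fV: "f w \<in> verts G" if "w \<in> verts F" for w using that g(1) x by (auto simp: f_def Q_def)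
  have "inj_on f (verts F)"
    using g(2) gx by (auto simp: inj_on_def f_def Q_def)
  moreover have "f ` d \<in> edges G" if d: "d \<in> edges F" for d
  proof -
    obtain a b where ab: "d = {a, b}" "a \<noteq> b" "a \<in> verts F" "b \<in> verts F" using edgeE[OF F d] by metis
    consider "a = u" | "b = u" | "a \<noteq> u" "b \<noteq> u" by blast
    then have "{f a, f b} \<in> edges G"
    proof cases
      case 1
      then show ?thesis using ab g(1)[of b] by (auto simp: f_def Q_def)
    next
      case 2
      then show ?thesis using ab g(1)[of a] by (auto simp: f_def Q_def insert_commute)
    next
      case 3
      then have "d \<noteq> e" using ab uv(1) by auto
      then show ?thesis using 3 ab col(2)[of a b] d g(3)[of a b] by (auto simp: f_def Q_def)
    qed
    then show ?thesis using ab(1) by simp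
  qed
  moreover have "f \<in> verts F \<rightarrow>\<^sub>E verts G" using fV by (auto simp: f_def)
  ultimately have "f \<in> embeddings F G" by (simp add: embeddings_def)
  then show ?thesis using free_of_iff[OF F] by blast
qed

text \<open>An embedding of \<open>F\<close> with the critical edge at \<open>{x, y}\<close>.\<close>

lemma color_critical_not_free_edge:
  assumes F: "finite_simple_graph F" and crit: "color_critical_edge F e"
    and G: "finite_simple_graph G" and xy: "{x, y} \<in> edges G" "p x = i" "p y = i"
    and i: "i < chromatic_number F - 1"
    and own: "s \<le> card ({z \<in> verts G. p z = i} - {x, y})"
    and nb: "\<And>j. j < chromatic_number F - 1 \<Longrightarrow> j \<noteq> i \<Longrightarrow>
      s \<le> card {z \<in> verts G. p z = j \<and> {x, z} \<in> edges G \<and> {y, z} \<in> edges G}"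
    and s: "s > 0" "2 * card (verts F) ^ 2 *
      (2 * card (edges (partite_graph (verts G) p) - edges G) + card (verts G)) \<le> s ^ 2"
  shows "\<not> free_of F G"
proof -
  obtain u v col where uv: "e = {u, v}" "u \<noteq> v" "u \<in> verts F" "v \<in> verts F"
    and col: "col ` verts F \<subseteq> {..<chromatic_number F - 1}" "col u = i" "col v = i"
      "\<And>a b. {a, b} \<in> edges F \<Longrightarrow> {a, b} \<noteq> e \<Longrightarrow> col a \<noteq> col b"
    using color_critical_edge_coloring[OF F crit i] by metis
  have finF: "finite (verts F)" using F by (simp add: finite_simple_graph_def)
  have xyV: "x \<noteq> y" "x \<in> verts G" "y \<in> verts G" using edge_doubletonD[OF G xy(1)] by auto
  define Q where "Q = verts F - {u, v}"
  \<comment> \<open>A vertex coloured \<open>i\<close> is not adjacent in \<open>F\<close> to an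
    endpoint of the critical edge, except along that edge, so its image only has to avoid
    \<open>x\<close> and \<open>y\<close>. All other images are taken among common
    neighbours.\<close>
  define U where "U = (\<lambda>q. if col q = i then {z \<in> verts G. p z = i} - {x, y}
    else {z \<in> verts G. p z = col q \<and> {x, z} \<in> edges G \<and> {y, z} \<in> edges G})"
  have "card Q \<le> card (verts F)" using finF by (auto simp: Q_def intro: card_mono)
  then have "2 * card Q ^ 2 * (2 * card (edges (partite_graph (verts G) p) - edges G) + card (verts G))
      \<le> 2 * card (verts F) ^ 2 * (2 * card (edges (partite_graph (verts G) p) - edges G) + card (verts G))"
    by (intro mult_le_mono1 mult_le_mono2 power_mono) auto
  also note s(2)
  finally have sQ: "2 * card Q ^ 2 *
    (2 * card (edges (partite_graph (verts G) p) - edges G) + card (verts G)) \<le> s ^ 2" .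
  have "finite Q" using finF by (simp add: Q_def)
  have U: "U q \<subseteq> {x \<in> verts G. p x = col q}" "s \<le> card (U q)" if "q \<in> Q" for q
    using that own nb col(1) by (auto simp: U_def Q_def image_subset_iff)
  obtain g where g: "\<And>q. q \<in> Q \<Longrightarrow> g q \<in> U q"
    "inj_on g Q" "\<And>q q'. q \<in> Q \<Longrightarrow> q' \<in> Q \<Longrightarrow> col q \<noteq> col q' \<Longrightarrow> {g q, g q'} \<in> edges G"
  proof (rule exists_crossing_choice[OF G \<open>finite Q\<close>, of U p col s])
  qed (use U s(1) sQ in blast)+
  define f where "f = (\<lambda>w\<in>verts F. if w = u then x else if w = v then y else g w)"
  have gV: "g q \<in> verts G" "p (g q) = col q" if "q \<in> Q" for q
    using g(1)[OF that] by (auto simp: U_def split: if_splits)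
  have gxy: "g q \<noteq> x" "g q \<noteq> y" if "q \<in> Q" for q
    using g(1)[OF that] xy(2,3) by (auto simp: U_def split: if_splits)
  have nbr: "{x, g q} \<in> edges G" "{y, g q} \<in> edges G" if "q \<in> Q" "col q \<noteq> i" for q
    using g(1)[OF that(1)] that(2) by (auto simp: U_def)
  have fV: "f w \<in> verts G" if "w \<in> verts F" for w
    using that gV(1)[of w] xyV by (auto simp: f_def Q_def)
  have fQ: "f q = g q" if "q \<in> Q" for q using that by (simp add: f_def Q_def)
  have fuv: "f u = x" "f v = y" using uv by (simp_all add: f_def)
  have "inj_on f (verts F)"
  proof (rule inj_onI)
    fix a b assume ab: "a \<in> verts F" "b \<in> verts F" "f a = f b"
    have cases: "a \<in> Q \<or> a = u \<or> a = v" "b \<in> Q \<or> b = u \<or> b = v" using ab by (auto simp: Q_def)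
    show "a = b"
    proof (cases "a \<in> Q \<and> b \<in> Q")
      case True
      then show ?thesis using ab(3) fQ g(2) by (simp add: inj_on_eq_iff)
    next
      case False
      then show ?thesis using cases ab(3) fuv xyV(1) gxy[of a] gxy[of b] fQ[of a] fQ[of b] by auto
    qed
  qed
  \<comment> \<open>One orientation only; the remaining edges have their second vertex in
    \<open>{u, v}\<close> and follow by swapping.\<close>
  moreover have half: "{f a, f b} \<in> edges G" if "{a, b} \<in> edges F" "a \<in> {u, v} \<or> (a \<in> Q \<and> b \<in> Q)" for a b
  proof -
    have ab: "a \<noteq> b" "a \<in> verts F" "b \<in> verts F" using edge_doubletonD[OF F that(1)] by auto
    show ?thesis
    proof (cases "{a, b} = e")
      case True
      then have "{f a, f b} = {x, y}"
        using ab uv by (auto simp: f_def doubleton_eq_iff)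
      then show ?thesis using xy(1) by simp
    next
      case False
      then have c: "col a \<noteq> col b" using col(4) that(1) by blast
      show ?thesis
      proof (cases "a \<in> {u, v}")
        case True
        then have "b \<in> Q" "col b \<noteq> i" using c col(2,3) ab(3) by (auto simp: Q_def)
        then show ?thesis using nbr[of b] True ab uv(2) by (auto simp: f_def Q_def)
      next
        case False
        then show ?thesis using g(3)[of a b] c that(2) by (auto simp: f_def Q_def)
      qed
    qed
  qed
  moreover have "f ` d \<in> edges G" if d: "d \<in> edges F" for d
  proof -
    obtain a b where ab: "d = {a, b}" "a \<noteq> b" "a \<in> verts F" "b \<in> verts F" using edgeE[OF F d] by metis
    have "{f a, f b} \<in> edges G"
      using half[of a b] half[of b a] d ab by (auto simp: Q_def insert_commute)
    then show ?thesis using ab(1) by simp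
  qed
  moreover have "f \<in> verts F \<rightarrow>\<^sub>E verts G" using fV by (auto simp: f_def)
  ultimately have "f \<in> embeddings F G" by (simp add: embeddings_def)
  then show ?thesis using free_of_iff[OF F] by blast
qed

section \<open>Local consequences of a minimal partition\<close>

text \<open>Moving \<open>x\<close> to part \<open>j\<close> removes its edges into its own part
  from the inner edges and adds those into part \<open>j\<close>. New missing pairs all contain
  \<open>x\<close>, so there are at most \<open>card (verts G)\<close> of them.\<close>

lemma move_vertex_inequality:
  fixes G :: "'a ugraph"
  defines "I \<equiv> \<lambda>p. card (edges G - edges (partite_graph (verts G) p))"
    and "M \<equiv> \<lambda>p. card (edges (partite_graph (verts G) p) - edges G)"
  assumes G: "finite_simple_graph G" and x: "x \<in> verts G"
    and min: "L * I p + M p \<le> L * I (p(x := j)) + M (p(x := j))"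
  shows "L * card {y \<in> verts G. p y = p x \<and> {x, y} \<in> edges G} \<le>
    L * card {y \<in> verts G. p y = j \<and> {x, y} \<in> edges G} + card (verts G)"
proof (cases "p x = j")
  case False
  define N where "N = (\<lambda>i. {y \<in> verts G. p y = i \<and> {x, y} \<in> edges G})"
  let ?T = "\<lambda>p. edges (partite_graph (verts G) p)"
  let ?p = "p(x := j)"
  have finV: "finite (verts G)" using G by (simp add: finite_simple_graph_def)
  have finE: "finite (edges G)" "finite (?T p)" for p
    using finite_edges[OF G] finite_edges[OF finite_simple_partite_graph[OF finV]] by auto
  have finN: "finite (N i)" for i using finV by (simp add: N_def)
  have xN: "y \<noteq> x" "y \<in> verts G" if "y \<in> N i" for y i
    using that edge_doubletonD[OF G, of x y] by (auto simp: N_def)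
  have "inj_on (\<lambda>y. {x, y}) A" for A by (auto simp: inj_on_def doubleton_eq_iff)
  then have cardN: "card ((\<lambda>y. {x, y}) ` N i) = card (N i)" for i by (rule card_image)
  have I': "edges G - ?T ?p \<subseteq> ((edges G - ?T p) - (\<lambda>y. {x, y}) ` N (p x)) \<union> (\<lambda>y. {x, y}) ` N j"
  proof
    fix e assume e: "e \<in> edges G - ?T ?p"
    then obtain u v where uv: "e = {u, v}" "u \<noteq> v" "u \<in> verts G" "v \<in> verts G" using edgeE[OF G] by (metis DiffD1)
    then have peq: "?p u = ?p v" using e by auto
    show "e \<in> ((edges G - ?T p) - (\<lambda>y. {x, y}) ` N (p x)) \<union> (\<lambda>y. {x, y}) ` N j"
    proof (cases "x \<in> e")
      case True
      then obtain y where y: "e = {x, y}" "y \<noteq> x" "y \<in> verts G" using uv by auto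
      then have "p y = j" using e x by (auto split: if_splits)
      then have "y \<in> N j" using y e by (auto simp: N_def)
      then show ?thesis using y(1) by blast
    next
      case False
      then have "p u = p v" using peq uv(1) by auto
      then have "e \<notin> ?T p" using uv by simp
      then show ?thesis using e False by auto
    qed
  qed
  have sub: "(\<lambda>y. {x, y}) ` N (p x) \<subseteq> edges G - ?T p" by (auto simp: N_def)
  have "I ?p \<le> card (((edges G - ?T p) - (\<lambda>y. {x, y}) ` N (p x)) \<union> (\<lambda>y. {x, y}) ` N j)"
    unfolding I_def using finE finN by (intro card_mono[OF _ I']) auto
  also have "\<dots> \<le> card ((edges G - ?T p) - (\<lambda>y. {x, y}) ` N (p x)) + card (N j)"
    unfolding cardN[symmetric] by (rule card_Un_le)
  also have "card ((edges G - ?T p) - (\<lambda>y. {x, y}) ` N (p x)) = I p - card (N (p x))"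
    using card_Diff_subset[OF _ sub] finN by (simp add: I_def cardN)
  finally have "I ?p \<le> I p - card (N (p x)) + card (N j)" .
  moreover have "card (N (p x)) \<le> I p"
    unfolding I_def cardN[symmetric] using finE by (intro card_mono[OF _ sub]) auto
  ultimately have "I ?p + card (N (p x)) \<le> I p + card (N j)" by linarith
  then have LI: "L * I ?p + L * card (N (p x)) \<le> L * I p + L * card (N j)"
    by (metis add_mult_distrib2 mult_le_mono2)
  have M': "?T ?p - edges G \<subseteq> (?T p - edges G) \<union> (\<lambda>y. {x, y}) ` verts G"
  proof
    fix e assume e: "e \<in> ?T ?p - edges G"
    then obtain u v where uv: "e = {u, v}" "u \<in> verts G" "v \<in> verts G" "?p u \<noteq> ?p v"
      by (auto simp: partite_graph_def)
    show "e \<in> (?T p - edges G) \<union> (\<lambda>y. {x, y}) ` verts G"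
    proof (cases "u = x \<or> v = x")
      case True
      then show ?thesis using uv by auto
    next
      case False
      then show ?thesis using uv e by auto
    qed
  qed
  have "M ?p \<le> card ((?T p - edges G) \<union> (\<lambda>y. {x, y}) ` verts G)"
    unfolding M_def using finE finV by (intro card_mono[OF _ M']) auto
  also have "\<dots> \<le> M p + card ((\<lambda>y. {x, y}) ` verts G)" unfolding M_def by (rule card_Un_le)
  also have "card ((\<lambda>y. {x, y}) ` verts G) \<le> card (verts G)" using finV by (rule card_image_le)
  finally have "M ?p \<le> M p + card (verts G)" by simp
  then show ?thesis using min LI by (simp add: N_def)
qed simp

text \<open>Let \<open>B\<close> be the set of vertices in at least \<gamma>' n missing pairs. Every
  inner edge meets \<open>B\<close> and every vertex has at most \<gamma> n inner neighbours, so
  there are at most |B| \<gamma> n inner edges, while |B| \<gamma>' n is at most twice the number of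
  missing pairs. The choice \<gamma> = \<beta> \<gamma>' / 2 gives the claim.\<close>

lemma color_critical_inner_le_missing:
  fixes F :: "'b ugraph" and c \<beta> :: real
  defines "k \<equiv> chromatic_number F - 1"
    and "I \<equiv> \<lambda>(G :: 'a ugraph) p. card (edges G - edges (partite_graph (verts G) p))"
    and "M \<equiv> \<lambda>(G :: 'a ugraph) p. card (edges (partite_graph (verts G) p) - edges G)"
  assumes F: "finite_simple_graph F" and crit: "color_critical_edge F e"
    and k: "1 < chromatic_number F" and c: "c > 0" and \<beta>: "\<beta> > 0"
  obtains L :: nat and \<epsilon> :: real and n\<^sub>0 :: nat where "L > 0" "\<epsilon> > 0"
    "\<And>n G p. n \<ge> n\<^sub>0 \<Longrightarrow> nvertex_graph n G \<Longrightarrow> free_of F G \<Longrightarrow> p ` verts G \<subseteq> {..<k} \<Longrightarrow>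
       (\<forall>i<k. c * real n \<le> real (card {x \<in> verts G. p x = i})) \<Longrightarrow>
       real (M G p) \<le> \<epsilon> * real n ^ 2 \<Longrightarrow>
       (\<forall>p'. p' ` verts G \<subseteq> {..<k} \<longrightarrow> L * I G p + M G p \<le> L * I G p' + M G p') \<Longrightarrow>
       real (I G p) \<le> \<beta> * real (M G p)"
proof -
  define \<gamma>' where "\<gamma>' = c / 4"
  define \<gamma> where "\<gamma> = \<beta> * \<gamma>' / 2"
  \<comment> \<open>\<sigma> n bounds the size of the candidate sets: \<gamma> n / 2 neighbours are
    guaranteed per part by the moving argument, and c n / 4 leaves room to delete two vertices or
    the non-neighbours of an inner edge.\<close>
  define \<sigma> where "\<sigma> = min (\<gamma> / 2) (c / 4)"
  define f where "f = real (card (verts F))"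
  \<comment> \<open>The embedding lemmas require 2 f^2 (2 |M| + n) \<le> s^2, where s \<ge> \<sigma>
    n / 2. Here \<epsilon> keeps the first summand below \<sigma>^2 n^2 / 8, and
    \<open>n\<^sub>0\<close> does the same for the second.\<close>
  define \<epsilon> where "\<epsilon> = \<sigma> ^ 2 / (32 * (f ^ 2 + 1))"
  \<comment> \<open>The n missing pairs caused by a move then weigh at most \<open>L\<close> times
    \<gamma> n / 2, half the weight of more than \<gamma> n inner edges.\<close>
  define L where "L = nat \<lceil>2 / \<gamma>\<rceil>"
  define n\<^sub>0 where "n\<^sub>0 = nat \<lceil>2 / \<sigma> + 16 * f ^ 2 / \<sigma> ^ 2\<rceil>"
  have pos: "\<gamma>' > 0" "\<gamma> > 0" "\<sigma> > 0" "f \<ge> 0" using c \<beta> by (auto simp: \<gamma>'_def \<gamma>_def \<sigma>_def f_def)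
  have \<sigma>: "\<sigma> \<le> \<gamma> / 2" "\<sigma> \<le> c / 4" by (auto simp: \<sigma>_def)
  have f1: "f ^ 2 + 1 > 0" by (simp add: add_nonneg_pos)
  have \<epsilon>: "\<epsilon> > 0" using pos(3) f1 by (simp add: \<epsilon>_def)
  have "4 * f ^ 2 * \<epsilon> = \<sigma> ^ 2 / 8 * (f ^ 2 / (f ^ 2 + 1))" using f1 by (simp add: \<epsilon>_def field_simps)
  also have "\<dots> \<le> \<sigma> ^ 2 / 8 * 1" using f1 by (intro mult_left_mono) (auto simp: divide_le_eq)
  finally have f\<epsilon>: "4 * f ^ 2 * \<epsilon> \<le> \<sigma> ^ 2 / 8" by simp
  have L: "2 / \<gamma> \<le> real L" unfolding L_def by linarith
  then have L0: "L > 0" using pos(2) by (simp add: L_def)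
  show ?thesis
  proof (rule that[OF L0 \<epsilon>, of n\<^sub>0])
    fix n and G :: "'a ugraph" and p
    assume n: "n \<ge> n\<^sub>0" and nG: "nvertex_graph n G" and free: "free_of F G"
      and p: "p ` verts G \<subseteq> {..<k}"
      and large: "\<forall>i<k. c * real n \<le> real (card {x \<in> verts G. p x = i})"
      and close: "real (M G p) \<le> \<epsilon> * real n ^ 2"
      and min: "\<forall>p'. p' ` verts G \<subseteq> {..<k} \<longrightarrow> L * I G p + M G p \<le> L * I G p' + M G p'"
    define s where "s = nat \<lfloor>\<sigma> * real n\<rfloor>"
    define MM where "MM = edges (partite_graph (verts G) p) - edges G"
    have M: "M G p = card MM" by (simp add: M_def MM_def)
    have G: "finite_simple_graph G" "card (verts G) = n" using nG by (auto simp: nvertex_graph_def)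
    have finV: "finite (verts G)" using G by (simp add: finite_simple_graph_def)
    have finMM: "finite MM"
      using finite_edges[OF finite_simple_partite_graph[OF finV]] by (simp add: MM_def)
    have "2 / \<sigma> + 16 * f ^ 2 / \<sigma> ^ 2 \<le> real n" using n unfolding n\<^sub>0_def by linarith
    moreover have "2 / \<sigma> \<ge> 0" "16 * f ^ 2 / \<sigma> ^ 2 \<ge> 0" using pos by auto
    ultimately have "2 / \<sigma> \<le> real n" "16 * f ^ 2 / \<sigma> ^ 2 \<le> real n" by linarith+
    then have n1: "2 \<le> \<sigma> * real n" "16 * f ^ 2 \<le> \<sigma> ^ 2 * real n"
      using pos(3) by (simp_all add: divide_le_eq mult.commute)
    have s: "\<sigma> * real n / 2 \<le> real s" "real s \<le> \<sigma> * real n" using n1(1) unfolding s_def by linarith+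
    have s0: "s > 0" using s(1) n1(1) by linarith
    have sb: "2 * card (verts F) ^ 2 * (2 * card MM + card (verts G)) \<le> s ^ 2"
    proof -
      have "2 * f ^ 2 * (2 * real (card MM) + real n) = 4 * f ^ 2 * real (card MM) + 2 * f ^ 2 * real n"
        by (simp add: algebra_simps)
      also have "\<dots> \<le> 4 * f ^ 2 * (\<epsilon> * real n ^ 2) + \<sigma> ^ 2 * real n / 8 * real n"
        using close n1(2) M by (intro add_mono mult_left_mono mult_right_mono) auto
      also have "\<dots> = (4 * f ^ 2 * \<epsilon>) * real n ^ 2 + \<sigma> ^ 2 * real n ^ 2 / 8"
        by (simp add: power2_eq_square)
      also have "\<dots> \<le> \<sigma> ^ 2 / 8 * real n ^ 2 + \<sigma> ^ 2 * real n ^ 2 / 8"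
        using f\<epsilon> by (intro add_right_mono mult_right_mono) auto
      also have "\<dots> = (\<sigma> * real n / 2) ^ 2" by (simp add: power_mult_distrib power_divide)
      also have "\<dots> \<le> real s ^ 2" using s(1) n1(1) by (intro power_mono) auto
      finally have "real (2 * card (verts F) ^ 2 * (2 * card MM + card (verts G))) \<le> real (s ^ 2)"
        by (simp add: f_def G)
      then show ?thesis by (rule of_nat_le_iff[THEN iffD1])
    qed
    define d where "d = (\<lambda>x. card {y \<in> verts G. p y = p x \<and> {x, y} \<in> edges G})"
    have d: "real (d x) \<le> \<gamma> * real n" if x: "x \<in> verts G" for x
    proof (rule ccontr)
      assume "\<not> real (d x) \<le> \<gamma> * real n"
      have "s \<le> card {y \<in> verts G. p y = j \<and> {x, y} \<in> edges G}" (is "s \<le> ?dj") if "j < chromatic_number F - 1" for j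
      proof -
        have "p(x := j) ` verts G \<subseteq> {..<k}" using p that by (auto simp: k_def)
        from move_vertex_inequality[OF G(1) x min[rule_format, OF this, unfolded I_def M_def]]
        have "L * d x \<le> L * ?dj + n" by (simp add: d_def G)
        from of_nat_mono[OF this, where ?'a = real]
        have "real L * real (d x) \<le> real L * real ?dj + real n" by simp
        moreover have "real L * (\<gamma> * real n) \<le> real L * real (d x)"
          using \<open>\<not> real (d x) \<le> \<gamma> * real n\<close> by (intro mult_left_mono) auto
        moreover have "real n \<le> real L * (\<gamma> * real n / 2)"
        proof -
          have "2 \<le> real L * \<gamma>" using L pos(2) by (simp add: divide_le_eq)
          then have "2 * real n \<le> (real L * \<gamma>) * real n" by (intro mult_right_mono) auto
          then show ?thesis by simp
        qed
        ultimately have "real L * (\<gamma> * real n / 2) \<le> real L * real ?dj" by (simp add: field_simps)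
        moreover have "real L > 0" using L pos(2) by (smt (verit) divide_pos_pos)
        ultimately have "\<gamma> * real n / 2 \<le> real ?dj" by simp
        moreover have "\<sigma> * real n \<le> \<gamma> / 2 * real n" using \<sigma>(1) by (intro mult_right_mono) auto
        ultimately show ?thesis using s(2) by simp
      qed
      from color_critical_not_free_star[OF F crit k G(1) x this s0 sb[unfolded MM_def]] free
      show False by simp
    qed
    define B where "B = {x \<in> verts G. \<gamma>' * real n \<le> real (card {y \<in> verts G. {x, y} \<in> MM})}"
    have finB: "finite B" using finV by (simp add: B_def)
    have cn: "2 * real s \<le> c * real n / 2" "c * real n / 2 \<ge> 4"
    proof -
      have "\<sigma> * real n \<le> c / 4 * real n" using \<sigma>(2) by (intro mult_right_mono) auto
      then show "2 * real s \<le> c * real n / 2" "c * real n / 2 \<ge> 4" using s(2) n1(1) by linarith+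
    qed
    \<comment> \<open>If neither endpoint is in \<open>B\<close>, each misses at most c n / 4
      vertices, so at least c n / 2 common neighbours remain in every other part and the critical
      edge can be placed at \<open>{x, y}\<close>.\<close>
    have meets_B: "x \<in> B \<or> y \<in> B" if xy: "{x, y} \<in> edges G" "p x = p y" for x y
    proof (rule ccontr)
      assume nB: "\<not> (x \<in> B \<or> y \<in> B)"
      have xyV: "x \<in> verts G" "y \<in> verts G" using edge_doubletonD[OF G(1) xy(1)] by auto
      have few: "real (card {z \<in> verts G. {w, z} \<in> MM}) \<le> \<gamma>' * real n" if "w \<in> {x, y}" for w
        using nB xyV that by (auto simp: B_def)
      have i: "p x < chromatic_number F - 1" using p xyV by (auto simp: k_def)
      have own: "s \<le> card ({z \<in> verts G. p z = p x} - {x, y})"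
      proof -
        have "card {z \<in> verts G. p z = p x} - card {x, y} \<le> card ({z \<in> verts G. p z = p x} - {x, y})"
          by (rule diff_card_le_card_Diff) simp
        moreover have "card {x, y} \<le> 2" by (cases "x = y") simp_all
        moreover have "c * real n \<le> real (card {z \<in> verts G. p z = p x})"
          using large i by (simp add: k_def)
        ultimately show ?thesis using cn by linarith
      qed
      have nb: "s \<le> card {z \<in> verts G. p z = j \<and> {x, z} \<in> edges G \<and> {y, z} \<in> edges G}"
        if j: "j < chromatic_number F - 1" "j \<noteq> p x" for j
      proof -
        let ?W = "{z \<in> verts G. p z = j}"
        let ?X = "\<lambda>w. {z \<in> verts G. {w, z} \<in> MM}"
        have "?W - (?X x \<union> ?X y) \<subseteq> {z \<in> verts G. p z = j \<and> {x, z} \<in> edges G \<and> {y, z} \<in> edges G}"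
          using j(2) xy(2) xyV by (auto simp: MM_def)
        then have "card (?W - (?X x \<union> ?X y)) \<le>
            card {z \<in> verts G. p z = j \<and> {x, z} \<in> edges G \<and> {y, z} \<in> edges G}"
          using finV by (intro card_mono) auto
        moreover have "card ?W - card (?X x \<union> ?X y) \<le> card (?W - (?X x \<union> ?X y))"
          using finV by (intro diff_card_le_card_Diff) auto
        moreover have "card (?X x \<union> ?X y) \<le> card (?X x) + card (?X y)" by (rule card_Un_le)
        moreover have "c * real n \<le> real (card ?W)" using large j by (simp add: k_def)
        moreover have "real (card (?X x)) \<le> c * real n / 4" "real (card (?X y)) \<le> c * real n / 4"
          using few by (auto simp: \<gamma>'_def)
        ultimately show ?thesis using cn by linarith
      qed
      from color_critical_not_free_edge[OF F crit G(1) xy(1) refl xy(2)[symmetric] i own nb s0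
          sb[unfolded MM_def]] free
      show False by simp
    qed
    have "real (I G p) \<le> real (card B) * (\<gamma> * real n)"
    proof -
      let ?N = "\<lambda>x. (\<lambda>y. {x, y}) ` {y \<in> verts G. p y = p x \<and> {x, y} \<in> edges G}"
      have "edges G - edges (partite_graph (verts G) p) \<subseteq> (\<Union>x\<in>B. ?N x)"
      proof
        fix e assume e: "e \<in> edges G - edges (partite_graph (verts G) p)"
        then obtain u v where uv: "e = {u, v}" "u \<in> verts G" "v \<in> verts G"
          using edgeE[OF G(1)] by (metis DiffD1)
        then have "p u = p v" using e by auto
        then have "e \<in> ?N u" "e \<in> ?N v" using e uv by (auto simp: insert_commute)
        moreover have "u \<in> B \<or> v \<in> B" using meets_B \<open>p u = p v\<close> e uv(1) by blast
        ultimately show "e \<in> (\<Union>x\<in>B. ?N x)" by blast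
      qed
      then have "I G p \<le> card (\<Union>x\<in>B. ?N x)" unfolding I_def using finB finV by (intro card_mono) auto
      also have "\<dots> \<le> (\<Sum>x\<in>B. card (?N x))" by (rule card_UN_le[OF finB])
      also have "\<dots> \<le> (\<Sum>x\<in>B. d x)" unfolding d_def using finV by (intro sum_mono card_image_le) auto
      finally have "real (I G p) \<le> (\<Sum>x\<in>B. real (d x))" by (metis of_nat_le_iff of_nat_sum)
      also have "\<dots> \<le> real (card B) * (\<gamma> * real n)" using d by (intro sum_bounded_above) (auto simp: B_def)
      finally show ?thesis .
    qed
    \<comment> \<open>A missing pair is counted from at most two vertices of
      \<open>B\<close>.\<close>
    moreover have "real (card B) * (\<gamma>' * real n) \<le> 2 * real (card MM)"
    proof -
      have "real (card B) * (\<gamma>' * real n) \<le> (\<Sum>x\<in>B. real (card {y \<in> verts G. {x, y} \<in> MM}))"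
        by (rule sum_bounded_below) (simp add: B_def)
      also have "\<dots> = real (card (SIGMA x:B. {y \<in> verts G. {x, y} \<in> MM}))"
        using finB finV by (simp add: card_SigmaI)
      also have "card (SIGMA x:B. {y \<in> verts G. {x, y} \<in> MM}) \<le> card {(x, y). {x, y} \<in> MM}"
        using card_ordered_pairs_le(1)[OF finMM] by (intro card_mono) auto
      also have "card {(x, y). {x, y} \<in> MM} \<le> 2 * card MM" by (rule card_ordered_pairs_le(2)[OF finMM])
      finally show ?thesis by simp
    qed
    moreover have "real (card B) * (\<gamma> * real n) = \<beta> / 2 * (real (card B) * (\<gamma>' * real n))"
      by (simp add: \<gamma>_def)
    moreover have "\<beta> / 2 * (real (card B) * (\<gamma>' * real n)) \<le> \<beta> / 2 * (2 * real (card MM))"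
      using calculation(2) \<beta> by (intro mult_left_mono) auto
    ultimately show "real (I G p) \<le> \<beta> * real (M G p)" by (simp add: M)
  qed
qed

section \<open>The extremal graphs\<close>

text \<open>Two transpositions of colours suffice: the first brings \<open>u\<close> to
  \<open>i\<close>, the second brings \<open>v\<close> to \<open>j\<close> and fixes
  \<open>i\<close>, as neither of the colours it swaps is \<open>i\<close>.\<close>

lemma coloring_with_values:
  assumes "colorable k H" "{u, v} \<in> edges H" "u \<in> verts H" "v \<in> verts H" "i < k" "j < k" "i \<noteq> j"
  obtains col :: "'a \<Rightarrow> nat" where "col ` verts H \<subseteq> {..<k}" "col u = i" "col v = j"
    "\<And>a b. {a, b} \<in> edges H \<Longrightarrow> col a \<noteq> col b"
proof -
  obtain c :: "'a \<Rightarrow> nat" where c: "c ` verts H \<subseteq> {..<k}" "\<And>a b. {a, b} \<in> edges H \<Longrightarrow> c a \<noteq> c b"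
    using assms(1) by (auto simp: colorable_def)
  define t where "t = (\<lambda>(a :: nat) b w. if w = a then b else if w = b then a else w)"
  have t: "t a b a = b" "w \<noteq> a \<Longrightarrow> w \<noteq> b \<Longrightarrow> t a b w = w" "t a b w = t a b w' \<longleftrightarrow> w = w'"
    "a < k \<Longrightarrow> b < k \<Longrightarrow> w < k \<Longrightarrow> t a b w < k" for a b w w'
    by (auto simp: t_def)
  define c\<^sub>1 where "c\<^sub>1 = (\<lambda>w. t (c u) i (c w))"
  define col where "col = (\<lambda>w. t (c\<^sub>1 v) j (c\<^sub>1 w))"
  have "c u < k" "c v < k" using c(1) assms(3,4) by auto
  then have "c\<^sub>1 v < k" using t(4) assms(5) by (simp add: c\<^sub>1_def)
  have c\<^sub>1u: "c\<^sub>1 u = i" by (simp add: c\<^sub>1_def t(1))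
  moreover have "c\<^sub>1 u \<noteq> c\<^sub>1 v" using c(2)[OF assms(2)] by (simp add: c\<^sub>1_def t(3))
  ultimately have "col u = i" unfolding col_def using t(2) assms(7) by metis
  moreover have "col v = j" by (simp add: col_def t(1))
  moreover have "col ` verts H \<subseteq> {..<k}"
  proof (rule image_subsetI)
    fix w assume "w \<in> verts H"
    then have "c\<^sub>1 w < k" using c(1) \<open>c u < k\<close> assms(5) t(4) by (auto simp: c\<^sub>1_def)
    then show "col w \<in> {..<k}" using t(4) \<open>c\<^sub>1 v < k\<close> assms(6) by (simp add: col_def)
  qed
  moreover have "col a \<noteq> col b" if "{a, b} \<in> edges H" for a b
    using c(2)[OF that] by (simp add: col_def c\<^sub>1_def t(3))
  ultimately show ?thesis using that by blast
qed

text \<open>Fix an edge of \<open>H\<close>, place it on \<open>e\<close>, and colour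
  \<open>H\<close> so that its endpoints get the parts of the endpoints of \<open>e\<close>. Each of
  the other h - 2 vertices may go anywhere in the part of its colour, as long as the images are
  distinct.\<close>

lemma many_copies_containing_crossing_edge:
  fixes H :: "'a ugraph" and c :: real
  assumes H: "finite_simple_graph H" and edgesH: "edges H \<noteq> {}" and col: "colorable k H" and c: "c > 0"
  obtains \<kappa> :: real and n\<^sub>0 :: nat where "\<kappa> > 0"
    "\<And>(V :: 'c set) p e. finite V \<Longrightarrow> n\<^sub>0 \<le> card V \<Longrightarrow> p ` V \<subseteq> {..<k} \<Longrightarrow>
       (\<And>i. i < k \<Longrightarrow> c * real (card V) \<le> real (card {x \<in> V. p x = i})) \<Longrightarrow>
       e \<in> edges (partite_graph V p) \<Longrightarrow>
       \<kappa> * real (card V) ^ (card (verts H) - 2) \<le>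
         real (card {K \<in> copies H (partite_graph V p). e \<in> edges K})"
proof -
  define h where "h = card (verts H)"
  \<comment> \<open>At least (c n / 4)^(h-2) choices, of which half are injective, and at most h^h
    embeddings for each copy.\<close>
  define \<kappa> where "\<kappa> = (c / 4) ^ (h - 2) / (2 * real h ^ h)"
  \<comment> \<open>The first term gives c n \<ge> 4, so that removing \<open>x\<close> and
    \<open>y\<close> leaves c n / 2 vertices in each part; the second gives 2 h^2 n \<le> (c n /
    4)^2.\<close>
  define n\<^sub>0 where "n\<^sub>0 = nat \<lceil>4 / c + 32 * real h ^ 2 / c ^ 2\<rceil>"
  obtain d where d: "d \<in> edges H" using edgesH by blast
  then obtain u v where uv: "d = {u, v}" "u \<noteq> v" "u \<in> verts H" "v \<in> verts H" using edgeE[OF H] by metis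
  have finH: "finite (verts H)" using H by (simp add: finite_simple_graph_def)
  have "h > 0" using uv(3) finH by (auto simp: h_def card_gt_0_iff)
  then have \<kappa>: "\<kappa> > 0" using c by (simp add: \<kappa>_def)
  show ?thesis
  proof (rule that[OF \<kappa>, of n\<^sub>0])
    fix V :: "'c set" and p e
    assume finV: "finite V" and n: "n\<^sub>0 \<le> card V" and p: "p ` V \<subseteq> {..<k}"
      and large: "\<And>i. i < k \<Longrightarrow> c * real (card V) \<le> real (card {x \<in> V. p x = i})"
      and e: "e \<in> edges (partite_graph V p)"
    define n where "n = card V"
    define T where "T = partite_graph V p"
    obtain x y where xy: "e = {x, y}" "x \<in> V" "y \<in> V" "p x \<noteq> p y" using e by (auto simp: partite_graph_def)
    then have "p x < k" "p y < k" using p by auto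
    then obtain col :: "'a \<Rightarrow> nat" where col: "col ` verts H \<subseteq> {..<k}" "col u = p x" "col v = p y"
      "\<And>a b. {a, b} \<in> edges H \<Longrightarrow> col a \<noteq> col b"
      using coloring_with_values[OF assms(3), of u v "p x" "p y"] d uv xy(4) by metis
    define s where "s = nat \<lfloor>c * real n / 2\<rfloor>"
    have "4 / c + 32 * real h ^ 2 / c ^ 2 \<le> real n" using n unfolding n\<^sub>0_def n_def by linarith
    moreover have "4 / c \<ge> 0" "32 * real h ^ 2 / c ^ 2 \<ge> 0" using c by auto
    ultimately have "4 / c \<le> real n" "32 * real h ^ 2 / c ^ 2 \<le> real n" by linarith+
    then have n1: "4 \<le> c * real n" "32 * real h ^ 2 \<le> c ^ 2 * real n"
      using c by (simp_all add: divide_le_eq mult.commute)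
    have s: "c * real n / 4 \<le> real s" "real s \<le> c * real n / 2" using n1(1) unfolding s_def by linarith+
    define Q where "Q = verts H - {u, v}"
    have Q: "finite Q" "card Q = h - 2" using finH uv by (auto simp: Q_def h_def card_Diff_subset)
    have "\<forall>q\<in>Q. \<exists>W. W \<subseteq> {z \<in> V. p z = col q} - {x, y} \<and> finite W \<and> card W = s"
    proof
      fix q assume "q \<in> Q"
      then have "col q < k" using col(1) by (auto simp: Q_def)
      have "card {z \<in> V. p z = col q} - card {x, y} \<le> card ({z \<in> V. p z = col q} - {x, y})"
        by (rule diff_card_le_card_Diff) simp
      moreover have "card {x, y} \<le> 2" by (cases "x = y") simp_all
      moreover have "c * real n \<le> real (card {z \<in> V. p z = col q})"
        using large[OF \<open>col q < k\<close>] by (simp add: n_def)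
      ultimately have "s \<le> card ({z \<in> V. p z = col q} - {x, y})" using s n1(1) by linarith
      from obtain_subset_with_card_n[OF this]
      show "\<exists>W. W \<subseteq> {z \<in> V. p z = col q} - {x, y} \<and> finite W \<and> card W = s" by blast
    qed
    then obtain W where W: "\<And>q. q \<in> Q \<Longrightarrow> W q \<subseteq> {z \<in> V. p z = col q} - {x, y} \<and> finite (W q) \<and> card (W q) = s"
      by (auto dest!: bchoice)
    \<comment> \<open>In a complete multipartite graph no cross pair is missing, so only
      coincidences have to be avoided.\<close>
    define S where "S = {g \<in> Pi\<^sub>E Q W. \<forall>q\<in>Q. \<forall>q'\<in>Q. q \<noteq> q' \<longrightarrow> (g q, g q') \<notin> (\<lambda>z. (z, z)) ` V}"
    have "s ^ card Q \<le> 2 * card S"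
      unfolding S_def
    proof (rule card_PiE_avoiding[OF Q(1)])
      show "finite ((\<lambda>z. (z, z)) ` V) \<and> card ((\<lambda>z. (z, z)) ` V) \<le> n"
        using finV card_image_le[OF finV] by (simp add: n_def)
      have "2 * real h ^ 2 * real n = (32 * real h ^ 2) * real n / 16" by simp
      also have "\<dots> \<le> (c ^ 2 * real n) * real n / 16"
        using n1(2) by (intro divide_right_mono mult_right_mono) auto
      also have "\<dots> = (c * real n / 4) ^ 2" by (simp add: power2_eq_square)
      also have "\<dots> \<le> real s ^ 2" using s(1) c by (intro power_mono) auto
      finally have "real (2 * h ^ 2 * n) \<le> real (s ^ 2)" by simp
      then have "2 * h ^ 2 * n \<le> s ^ 2" by (rule of_nat_le_iff[THEN iffD1])
      moreover have "2 * card Q ^ 2 * n \<le> 2 * h ^ 2 * n"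
        by (intro mult_le_mono1 mult_le_mono2 power_mono) (auto simp: Q)
      ultimately show "2 * card Q ^ 2 * n \<le> s ^ 2" by linarith
    qed (use W in blast)
    define ext where "ext = (\<lambda>g. \<lambda>w\<in>verts H. if w = u then x else if w = v then y else g w)"
    have extQ: "ext g q = g q" if "q \<in> Q" for g q using that by (simp add: ext_def Q_def)
    have extuv: "ext g u = x" "ext g v = y" for g using uv by (auto simp: ext_def)
    have "inj_on ext S"
    proof (rule inj_onI)
      fix g g' assume g: "g \<in> S" "g' \<in> S" "ext g = ext g'"
      show "g = g'"
      proof (rule PiE_ext[of _ Q W])
        show "g q = g' q" if "q \<in> Q" for q using extQ[OF that] g(3) by metis
      qed (use g in \<open>auto simp: S_def\<close>)
    qed
    then have "card (ext ` S) = card S" by (rule card_image)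
    let ?C = "{K \<in> copies H T. e \<in> edges K}"
    have "ext g \<in> embeddings H T \<and> image_graph (ext g) H \<in> ?C" if g: "g \<in> S" for g
    proof -
      have gW: "g q \<in> V" "p (g q) = col q" "g q \<noteq> x" "g q \<noteq> y" if "q \<in> Q" for q
        using g W[OF that] that by (auto simp: S_def PiE_iff)
      have split: "w \<in> Q \<or> w = u \<or> w = v" if "w \<in> verts H" for w using that by (auto simp: Q_def)
      have ext: "ext g w \<in> V" "p (ext g w) = col w" if "w \<in> verts H" for w
        using split[OF that] gW extQ extuv col(2,3) xy by auto
      have "inj_on (ext g) (verts H)"
      proof (rule inj_onI)
        fix a b assume ab: "a \<in> verts H" "b \<in> verts H" "ext g a = ext g b"
        show "a = b"
        proof (cases "a \<in> Q \<and> b \<in> Q")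
          case True
          then have "g a = g b" using ab(3) extQ by simp
          then have "(g a, g b) \<in> (\<lambda>z. (z, z)) ` V" using gW(1) True by auto
          then show ?thesis using g True by (auto simp: S_def)
        next
          case False
          have "x \<noteq> y" using xy(4) by auto
          then show ?thesis
            using False split[OF ab(1)] split[OF ab(2)] ab(3) extuv[of g] gW(3,4)[of a] gW(3,4)[of b]
              extQ[of a g] extQ[of b g] by auto
        qed
      qed
      moreover have "ext g ` d' \<in> edges T" if "d' \<in> edges H" for d'
      proof -
        obtain a b where ab: "d' = {a, b}" "a \<noteq> b" "a \<in> verts H" "b \<in> verts H"
          using edgeE[OF H \<open>d' \<in> edges H\<close>] by metis
        then show ?thesis using ext col(4)[of a b] \<open>d' \<in> edges H\<close> by (simp add: T_def)
      qed
      moreover have "ext g \<in> verts H \<rightarrow>\<^sub>E verts T" using ext(1) by (auto simp: T_def ext_def)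
      ultimately have emb: "ext g \<in> embeddings H T" by (simp add: embeddings_def)
      moreover have "ext g ` d = e" using extuv uv(1) xy(1) by simp
      then have "e \<in> edges (image_graph (ext g) H)" using d by (auto simp: image_graph_def)
      ultimately show ?thesis using copies_eq_image[OF H, of T] by blast
    qed
    then have "card (ext ` S) \<le> card ?C * h ^ h"
      unfolding h_def using finite_copies[OF H, of T] finV
      by (intro card_embeddings_le_copies[OF H, of _ _ T]) (auto simp: T_def)
    then have "s ^ (h - 2) \<le> 2 * (card ?C * h ^ h)"
      using \<open>s ^ card Q \<le> 2 * card S\<close> \<open>card (ext ` S) = card S\<close> Q(2) by simp
    from of_nat_mono[OF this, where ?'a = real]
    have "real s ^ (h - 2) \<le> real (card ?C) * (2 * real h ^ h)" by (simp add: ac_simps)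
    moreover have "(c / 4 * real n) ^ (h - 2) \<le> real s ^ (h - 2)" using s(1) c by (intro power_mono) auto
    ultimately have "(c / 4) ^ (h - 2) * real n ^ (h - 2) \<le> real (card ?C) * (2 * real h ^ h)"
      unfolding power_mult_distrib by linarith
    then have "\<kappa> * real n ^ (h - 2) \<le> real (card ?C)"
      using \<open>h > 0\<close> by (simp add: \<kappa>_def divide_le_eq)
    then show "\<kappa> * real (card V) ^ (card (verts H) - 2) \<le>
         real (card {K \<in> copies H (partite_graph V p). e \<in> edges K})"
      by (simp add: n_def h_def T_def)
  qed
qed

section \<open>Coloured counts against complete multipartite graphs\<close>

lemma num_copies_color_all_red:
  assumes "finite_simple_graph G"
  shows "num_copies_col H (complete_graph 2) G (\<lambda>_. Red) = num_copies H G"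
  unfolding num_copies_col_eq[OF assms] color_subgraph_def by simp

text \<open>When \<open>H\<close> is a single edge, red and blue edges count alike, so the colouring
  is irrelevant. This covers h = 2, where a blue edge is not outweighed by the copies that it
  destroys.\<close>

lemma num_copies_col_single_edge:
  assumes "finite_simple_graph H" "card (verts H) = 2" "edges H \<noteq> {}" and G: "finite_simple_graph G"
  shows "num_copies_col H (complete_graph 2) G c = num_copies H G"
proof -
  have "edges G = {e \<in> edges G. c e = Red} \<union> {e \<in> edges G. c e = Blue}"
    using color.exhaust by blast
  then have "card (edges G) = card {e \<in> edges G. c e = Red} + card {e \<in> edges G. c e = Blue}"
    using finite_edges[OF G] by (subst card_Un_disjoint[symmetric]) auto
  then show ?thesis
    using num_copies_single_edge[OF assms(1-3) finite_simple_color_subgraph[OF G, of Red c]]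
      num_copies_single_edge[OF assms(1-3) G]
    by (simp add: num_copies_col_eq[OF G] color_subgraph_def)
qed

text \<open>Each missing cross pair destroys \<open>\<kappa> n^(h - 2)\<close> copies, each inner edge creates at most
  \<open>h\<^sup>2 n^(h - 2)\<close>, and for \<open>h \<ge> 3\<close> recolouring an edge blue earns only one.\<close>

lemma num_copies_col_le_partite:
  fixes G :: "'c ugraph" and H :: "'a ugraph" and \<kappa> :: real
  defines "T \<equiv> \<lambda>p. partite_graph (verts G) p" and "h \<equiv> card (verts H)" and "n \<equiv> card (verts G)"
  assumes H: "finite_simple_graph H" and h: "h \<ge> 2" and G: "finite_simple_graph G" and \<kappa>: "\<kappa> > 0"
    and many: "\<And>e. e \<in> edges (T p) \<Longrightarrow>
      \<kappa> * real n ^ (h - 2) \<le> real (card {K \<in> copies H (T p). e \<in> edges K})"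
    and inner: "real (card (edges G - edges (T p))) \<le>
      min 1 (\<kappa> / (4 * real h ^ 4)) * real (card (edges (T p) - edges G))"
    and blue: "h \<ge> 3 \<or> {e \<in> edges G. c e = Blue} = {}" and n: "n \<ge> 1" "4 * real h ^ 2 \<le> \<kappa> * real n"
  shows "num_copies_col H (complete_graph 2) G c \<le> num_copies H (T p)"
proof -
  define R where "R = color_subgraph Red c G"
  define N where "N = real n ^ (h - 2)"
  define b where "b = card {e \<in> edges G. c e = Blue}"
  define I where "I = edges G - edges (T p)"
  \<comment> \<open>Missing and blue cross pairs together: neither is available to red
    copies.\<close>
  define m where "m = card (edges (T p) - edges R)"
  define X where "X = copies H R - copies H (T p)"
  define Y where "Y = copies H (T p) - copies H R"
  have finV: "finite (verts G)" using G by (simp add: finite_simple_graph_def)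
  have R: "finite_simple_graph R" "verts R = verts G" "edges R \<subseteq> edges G"
    using finite_simple_color_subgraph[OF G] by (auto simp: R_def color_subgraph_def)
  have fin: "finite (edges (T p))" "finite (edges G)" "finite (edges R)"
    using finite_edges[OF finite_simple_partite_graph[OF finV]] finite_edges[OF G] finite_edges[OF R(1)]
    by (auto simp: T_def)
  have finC: "finite (copies H R)" "finite (copies H (T p))"
    using finV R(2) by (auto simp: T_def intro: finite_copies[OF H])
  have N: "N \<ge> 1" using n(1) by (simp add: N_def)
  have h4: "real h ^ 4 > 0" using h by simp
  have "card (edges (T p) - edges G) \<le> m"
    unfolding m_def using R(3) fin by (intro card_mono) auto
  moreover have "real (card I) \<le> min 1 (\<kappa> / (4 * real h ^ 4)) * real (card (edges (T p) - edges G))"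
    using inner by (simp add: I_def)
  moreover have "min 1 (\<kappa> / (4 * real h ^ 4)) \<ge> 0" using \<kappa> by simp
  ultimately have cardI: "real (card I) \<le> min 1 (\<kappa> / (4 * real h ^ 4)) * real m"
    by (meson mult_left_mono of_nat_mono order_trans)
  have "min 1 (\<kappa> / (4 * real h ^ 4)) * real m \<le> 1 * real m" by (intro mult_right_mono) auto
  then have I1: "real (card I) \<le> real m" using cardI by linarith
  have "min 1 (\<kappa> / (4 * real h ^ 4)) * real m \<le> \<kappa> / (4 * real h ^ 4) * real m"
    by (intro mult_right_mono) auto
  then have "real (card I) \<le> \<kappa> / (4 * real h ^ 4) * real m" using cardI by linarith
  then have I2: "4 * real h ^ 4 * real (card I) \<le> \<kappa> * real m"
    using h4 by (simp add: pos_le_divide_eq mult.commute)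
  \<comment> \<open>The h^4 in the hypothesis on inner edges is spent in two halves: h^2 for the
    copies through one edge and h^2 for the edges of one copy, as in the bound for \<open>Y\<close>.
    Of the budget \<kappa> m N, a quarter goes to \<open>X\<close> and a half to the blue
    edges.\<close>
  have X: "real h ^ 2 * real (card X) \<le> \<kappa> * real m * N / 4"
  proof -
    have "card X \<le> card (edges R - edges (T p)) * (h ^ 2 * n ^ (h - 2))"
      unfolding X_def using card_copies_diff_le[OF H R(1), of "T p"] R(2) by (simp add: T_def h_def n_def)
    also have "\<dots> \<le> card I * (h ^ 2 * n ^ (h - 2))"
      unfolding I_def using R(3) fin by (intro mult_le_mono1 card_mono) auto
    finally have "real (card X) \<le> real (card I) * (real h ^ 2 * N)"
      unfolding N_def by (metis of_nat_le_iff of_nat_mult of_nat_power)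
    then have "real h ^ 2 * real (card X) \<le> real h ^ 2 * (real (card I) * (real h ^ 2 * N))"
      by (intro mult_left_mono) auto
    also have "\<dots> = (4 * real h ^ 4 * real (card I)) * N / 4"
      by (simp add: power2_eq_square power4_eq_xxxx)
    also have "\<dots> \<le> \<kappa> * real m * N / 4"
      using I2 N by (intro divide_right_mono mult_right_mono) auto
    finally show ?thesis .
  qed
  have Y: "\<kappa> * real m * N \<le> real h ^ 2 * real (card Y)"
  proof -
    define l where "l = nat \<lceil>\<kappa> * N\<rceil>"
    have "m * l \<le> card Y * h ^ 2"
      unfolding m_def
    proof (rule card_incidences_le)
      fix e assume e: "e \<in> edges (T p) - edges R"
      have "{K \<in> Y. e \<in> edges K} = {K \<in> copies H (T p). e \<in> edges K}"
        using e by (auto simp: Y_def copies_def subgraph_def)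
      then have "\<kappa> * N \<le> real (card {K \<in> Y. e \<in> edges K})" using many e by (simp add: N_def)
      then show "l \<le> card {K \<in> Y. e \<in> edges K}" unfolding l_def by linarith
    next
      fix K assume "K \<in> Y"
      then have "K \<in> copies H (T p)" by (simp add: Y_def)
      then show "finite (edges K) \<and> card (edges K) \<le> h ^ 2"
        using card_copy_edges[OF H] card_edges_le_power2[OF H] unfolding h_def by (meson le_trans)
    qed (use fin finC in \<open>auto simp: Y_def\<close>)
    then have "real m * real l \<le> real h ^ 2 * real (card Y)"
      by (metis mult.commute of_nat_le_iff of_nat_mult of_nat_power)
    moreover have "real m * (\<kappa> * N) \<le> real m * real l"
      unfolding l_def by (intro mult_left_mono) linarith+
    ultimately show ?thesis by (simp add: ac_simps)
  qed
  \<comment> \<open>A blue edge is inner or one of the \<open>m\<close> pairs, so b \<le> 2m. If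
    blue edges exist then h \<ge> 3, so N \<ge> n and \<kappa> N exceeds any fixed constant.\<close>
  have B: "real h ^ 2 * real b \<le> \<kappa> * real m * N / 2"
  proof (cases "{e \<in> edges G. c e = Blue} = {}")
    case True
    then have "b = 0" by (simp only: b_def card.empty)
    then show ?thesis using \<kappa> N by simp
  next
    case False
    then have "h - 2 \<ge> 1" using blue by auto
    then have "real n \<le> N" using power_increasing[of 1 "h - 2" "real n"] n(1) by (simp add: N_def)
    have "{e \<in> edges G. c e = Blue} \<subseteq> I \<union> (edges (T p) - edges R)"
      by (auto simp: I_def R_def color_subgraph_def)
    then have "b \<le> card (I \<union> (edges (T p) - edges R))"
      unfolding b_def using fin by (intro card_mono) (auto simp: I_def)
    also have "\<dots> \<le> card I + m" unfolding m_def by (rule card_Un_le)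
    finally have "real b \<le> 2 * real m" using I1 by linarith
    then have "real h ^ 2 * real b \<le> real h ^ 2 * (2 * real m)" by (intro mult_left_mono) auto
    also have "\<dots> = (4 * real h ^ 2) * real m / 2" by simp
    also have "\<dots> \<le> (\<kappa> * N) * real m / 2"
    proof -
      have "\<kappa> * real n \<le> \<kappa> * N" using \<open>real n \<le> N\<close> \<kappa> by (intro mult_left_mono) auto
      then show ?thesis using n(2) by (intro divide_right_mono mult_right_mono) auto
    qed
    finally show ?thesis by (simp add: ac_simps)
  qed
  have "real h ^ 2 * (real (card X) + real b) \<le> 3 / 4 * (\<kappa> * real m * N)"
    unfolding distrib_left using X B by linarith
  also have "\<dots> \<le> real h ^ 2 * real (card Y)"
  proof -
    have "\<kappa> * real m * N \<ge> 0" using \<kappa> N by simp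
    then show ?thesis using Y by linarith
  qed
  finally have "real (card X) + real b \<le> real (card Y)" using h by simp
  then have le: "card X + b \<le> card Y" by linarith
  have "num_copies H R = card (copies H R \<inter> copies H (T p)) + card X"
    unfolding num_copies_def X_def using finC card_Int_Diff by metis
  moreover have "num_copies H (T p) = card (copies H R \<inter> copies H (T p)) + card Y"
    unfolding num_copies_def Y_def using finC card_Int_Diff[of "copies H (T p)" "copies H R"]
    by (simp add: Int_commute)
  moreover have "num_copies_col H (complete_graph 2) G c = num_copies H R + b"
    by (simp add: num_copies_col_eq[OF G] R_def b_def)
  ultimately show ?thesis using le by linarith
qed

section \<open>Coloured extremal graphs on many vertices\<close>

lemma color_critical_edges_nonempty: "color_critical_edge F e \<Longrightarrow> edges F \<noteq> {}"
  by (auto simp: color_critical_edge_def)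

context
  fixes H :: "'a ugraph" and F :: "'b ugraph" and e :: "'b set"
  assumes H: "finite_simple_graph H" and F: "finite_simple_graph F"
    and chrom: "chromatic_number H < chromatic_number F"
    and stab: "weakly_Turan_stable F H" and crit: "color_critical_edge F e"
begin

text \<open>Being at least \<open>ex n H F\<close> replaces extremality of the coloured graph, so
  the statement survives recolouring everything red. For h \<ge> 3 the quadratic number of blue
  edges is negligible against n^h, and the uncoloured graph is itself near-extremal.\<close>

lemma near_extremal_col_le_partite:
  assumes k: "2 < chromatic_number F"
  obtains n\<^sub>0 where "\<And>n (G :: nat ugraph) c. n \<ge> n\<^sub>0 \<Longrightarrow> nvertex_graph n G \<Longrightarrow> free_of F G \<Longrightarrow>
     ex n H F \<le> num_copies_col H (complete_graph 2) G c \<Longrightarrow>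
     \<exists>p. p ` verts G = {..<chromatic_number F - 1} \<and>
       num_copies_col H (complete_graph 2) G c \<le> num_copies H (partite_graph (verts G) p)"
proof -
  define k where "k = chromatic_number F - 1"
  define h where "h = card (verts H)"
  have edgesH: "edges H \<noteq> {}" by (rule weakly_Turan_stable_imp_edges[OF H F color_critical_edges_nonempty[OF crit] stab k])
  then obtain d where "d \<in> edges H" by blast
  then have "card d = 2" "d \<subseteq> verts H" "finite (verts H)" using H by (auto simp: finite_simple_graph_def)
  then have h: "h \<ge> 2" unfolding h_def by (metis card_mono)
  have colH: "colorable k H"
    using colorable_mono[OF colorable_chromatic_number[OF H]] chrom by (simp add: k_def)
  let ?T = "\<lambda>(G :: nat ugraph) p. partite_graph (verts G) p"
  define I where "I = (\<lambda>(G :: nat ugraph) p. card (edges G - edges (?T G p)))"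
  define M where "M = (\<lambda>(G :: nat ugraph) p. card (edges (?T G p) - edges G))"
  obtain \<delta> :: real and n\<^sub>1 where \<delta>: "\<delta> > 0" and large:
    "\<And>n (G :: nat ugraph) p i. n \<ge> n\<^sub>1 \<Longrightarrow> nvertex_graph n G \<Longrightarrow> free_of F G \<Longrightarrow>
       real (num_copies H G) \<ge> real (ex n H F) - \<delta> * real n ^ h \<Longrightarrow> p ` verts G \<subseteq> {..<k} \<Longrightarrow>
       real (I G p) \<le> \<delta> * real n ^ 2 \<Longrightarrow> i < k \<Longrightarrow> \<delta> * real n \<le> real (card {x \<in> verts G. p x = i})"
    using weakly_Turan_stable_large_parts[OF H F color_critical_edges_nonempty[OF crit] stab k] unfolding k_def h_def I_def by blast
  obtain \<kappa> :: real and n\<^sub>2 where \<kappa>: "\<kappa> > 0" and many: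
    "\<And>(V :: nat set) p e. finite V \<Longrightarrow> n\<^sub>2 \<le> card V \<Longrightarrow> p ` V \<subseteq> {..<k} \<Longrightarrow>
       (\<And>i. i < k \<Longrightarrow> \<delta> * real (card V) \<le> real (card {x \<in> V. p x = i})) \<Longrightarrow>
       e \<in> edges (partite_graph V p) \<Longrightarrow>
       \<kappa> * real (card V) ^ (h - 2) \<le> real (card {K \<in> copies H (partite_graph V p). e \<in> edges K})"
    using many_copies_containing_crossing_edge[OF H edgesH colH \<delta>] unfolding h_def by blast
  define \<beta> where "\<beta> = min 1 (\<kappa> / (4 * real h ^ 4))"
  have \<beta>: "\<beta> > 0" using \<kappa> h by (simp add: \<beta>_def)
  have "1 < chromatic_number F" using k by simp
  obtain L :: nat and \<epsilon> :: real and n\<^sub>3 where L: "L > 0" and \<epsilon>: "\<epsilon> > 0" and inner: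
    "\<And>n (G :: nat ugraph) p. n \<ge> n\<^sub>3 \<Longrightarrow> nvertex_graph n G \<Longrightarrow> free_of F G \<Longrightarrow> p ` verts G \<subseteq> {..<k} \<Longrightarrow>
       (\<forall>i<k. \<delta> * real n \<le> real (card {x \<in> verts G. p x = i})) \<Longrightarrow>
       real (M G p) \<le> \<epsilon> * real n ^ 2 \<Longrightarrow>
       (\<forall>p'. p' ` verts G \<subseteq> {..<k} \<longrightarrow> L * I G p + M G p \<le> L * I G p' + M G p') \<Longrightarrow>
       real (I G p) \<le> \<beta> * real (M G p)"
    unfolding k_def I_def M_def
    by (fact color_critical_inner_le_missing[OF F crit \<open>1 < chromatic_number F\<close> \<delta> \<beta>])
  \<comment> \<open>The minimal weight is at most that of the partition from stability, hence at
    most L \<eta> n^2 = min \<delta> \<epsilon> n^2. This bounds inner edges by \<delta> n^2 and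
    missing pairs by \<epsilon> n^2.\<close>
  define \<eta> where "\<eta> = min \<delta> \<epsilon> / real L"
  have \<eta>: "\<eta> > 0" using \<delta> \<epsilon> L by (simp add: \<eta>_def)
  obtain \<delta>' :: real and n\<^sub>4 where \<delta>': "\<delta>' > 0" and close:
    "\<And>n (G :: nat ugraph). n \<ge> n\<^sub>4 \<Longrightarrow> nvertex_graph n G \<Longrightarrow> free_of F G \<Longrightarrow>
       real (num_copies H G) \<ge> real (ex n H F) - \<delta>' * real n ^ h \<Longrightarrow>
       \<exists>p. p ` verts G = {..<k} \<and> real (I G p + M G p) \<le> \<eta> * real n ^ 2"
    using weakly_Turan_stable_structure[OF stab \<eta>] unfolding k_def h_def I_def M_def by blast
  define \<theta> where "\<theta> = min \<delta> \<delta>'"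
  have \<theta>: "\<theta> > 0" using \<delta> \<delta>' by (simp add: \<theta>_def)
  define n\<^sub>5 where "n\<^sub>5 = nat \<lceil>1 / \<theta>\<rceil> + nat \<lceil>4 * real h ^ 2 / \<kappa>\<rceil> + 1"
  define n\<^sub>0 where "n\<^sub>0 = Max {n\<^sub>1, n\<^sub>2, n\<^sub>3, n\<^sub>4, n\<^sub>5}"
  have goal: "\<exists>p. p ` verts G = {..<k} \<and>
      num_copies_col H (complete_graph 2) G c \<le> num_copies H (?T G p)"
    if n: "n \<ge> n\<^sub>0" and nG: "nvertex_graph n G" and free: "free_of F G"
      and ext: "ex n H F \<le> num_copies_col H (complete_graph 2) G c"
      and blue: "h \<ge> 3 \<or> {e \<in> edges G. c e = Blue} = {}" for n and G :: "nat ugraph" and c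
  proof -
    have ns: "n\<^sub>1 \<le> n" "n\<^sub>2 \<le> n" "n\<^sub>3 \<le> n" "n\<^sub>4 \<le> n" "n\<^sub>5 \<le> n" using n by (auto simp: n\<^sub>0_def)
    have "1 / \<theta> \<le> real n" "4 * real h ^ 2 / \<kappa> \<le> real n" and n1: "n \<ge> 1"
      using ns(5) unfolding n\<^sub>5_def by linarith+
    then have n\<theta>: "1 \<le> \<theta> * real n" and n\<kappa>: "4 * real h ^ 2 \<le> \<kappa> * real n"
      using \<theta> \<kappa> by (simp_all add: divide_le_eq mult.commute)
    have G: "finite_simple_graph G" and cV: "card (verts G) = n" using nG by (auto simp: nvertex_graph_def)
    have finV: "finite (verts G)" using G by (simp add: finite_simple_graph_def)
    define b where "b = card {e \<in> edges G. c e = Blue}"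
    have "real b \<le> \<theta> * real n ^ h"
    proof (cases "{e \<in> edges G. c e = Blue} = {}")
      case True
      then have "b = 0" by (simp only: b_def card.empty)
      then show ?thesis using \<theta> by simp
    next
      case False
      then have "h \<ge> 3" using blue by blast
      have "b \<le> card (edges G)" unfolding b_def using finite_edges[OF G] by (intro card_mono) auto
      also have "\<dots> \<le> n ^ 2" using card_edges_le_power2[OF G] cV by simp
      finally have "real b \<le> 1 * real n ^ 2" by (metis mult_1 of_nat_le_iff of_nat_power)
      also have "\<dots> \<le> \<theta> * real n * real n ^ 2" using n\<theta> by (intro mult_right_mono) auto
      also have "\<dots> = \<theta> * real n ^ 3" by (simp add: power2_eq_square power3_eq_cube)
      also have "\<dots> \<le> \<theta> * real n ^ h"
        using \<theta> n1 \<open>h \<ge> 3\<close> by (intro mult_left_mono power_increasing) auto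
      finally show ?thesis .
    qed
    moreover have "ex n H F \<le> num_copies H G + b"
    proof -
      have "num_copies H (color_subgraph Red c G) \<le> num_copies H G"
        using finV by (intro num_copies_mono H) (auto simp: color_subgraph_def)
      then show ?thesis using ext by (simp add: num_copies_col_eq[OF G] b_def)
    qed
    ultimately have "real (ex n H F) - \<theta> * real n ^ h \<le> real (num_copies H G)" by linarith
    moreover have "\<theta> * real n ^ h \<le> \<delta> * real n ^ h" "\<theta> * real n ^ h \<le> \<delta>' * real n ^ h"
      by (auto simp: \<theta>_def intro: mult_right_mono)
    ultimately have near: "real (num_copies H G) \<ge> real (ex n H F) - \<delta> * real n ^ h"
      "real (num_copies H G) \<ge> real (ex n H F) - \<delta>' * real n ^ h" by linarith+
    obtain p\<^sub>0 where p\<^sub>0: "p\<^sub>0 ` verts G = {..<k}" "real (I G p\<^sub>0 + M G p\<^sub>0) \<le> \<eta> * real n ^ 2"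
      using close[OF ns(4) nG free near(2)] by blast
    let ?w = "\<lambda>p. L * I G p + M G p"
    \<comment> \<open>The minimum is over all maps into \<open>{..<k}\<close>, empty classes
      included, so that every move of a single vertex is admissible.\<close>
    obtain p where p: "p ` verts G \<subseteq> {..<k}" "\<And>p'. p' ` verts G \<subseteq> {..<k} \<Longrightarrow> ?w p \<le> ?w p'"
      using ex_has_least_nat[of "\<lambda>p. p ` verts G \<subseteq> {..<k}" p\<^sub>0 ?w] p\<^sub>0(1) by auto
    have "?w p \<le> ?w p\<^sub>0" using p(2) p\<^sub>0(1) by blast
    also have "\<dots> \<le> L * (I G p\<^sub>0 + M G p\<^sub>0)" using L by (simp add: distrib_left)
    finally have "real (?w p) \<le> real L * real (I G p\<^sub>0 + M G p\<^sub>0)" by (metis of_nat_le_iff of_nat_mult)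
    also have "\<dots> \<le> real L * (\<eta> * real n ^ 2)" using p\<^sub>0(2) by (intro mult_left_mono) auto
    also have "\<dots> = min \<delta> \<epsilon> * real n ^ 2" using L by (simp add: \<eta>_def)
    finally have w: "real (?w p) \<le> min \<delta> \<epsilon> * real n ^ 2" .
    have "I G p \<le> ?w p" using L by (simp add: trans_le_add1)
    moreover have "min \<delta> \<epsilon> * real n ^ 2 \<le> \<delta> * real n ^ 2" "min \<delta> \<epsilon> * real n ^ 2 \<le> \<epsilon> * real n ^ 2"
      by (auto intro: mult_right_mono)
    ultimately have IM: "real (I G p) \<le> \<delta> * real n ^ 2" "real (M G p) \<le> \<epsilon> * real n ^ 2"
      using w by linarith+
    have lp: "\<delta> * real n \<le> real (card {x \<in> verts G. p x = i})" if "i < k" for i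
      by (rule large[OF ns(1) nG free near(1) p(1) IM(1) that])
    have "num_copies_col H (complete_graph 2) G c \<le> num_copies H (?T G p)"
    proof (rule num_copies_col_le_partite[OF H _ G \<kappa>])
      show "\<kappa> * real (card (verts G)) ^ (card (verts H) - 2)
          \<le> real (card {K \<in> copies H (?T G p). e \<in> edges K})" if "e \<in> edges (?T G p)" for e
        unfolding h_def[symmetric] using many[OF finV _ p(1) _ that] lp ns(2) cV by simp
      show "real (card (edges G - edges (?T G p))) \<le>
          min 1 (\<kappa> / (4 * real (card (verts H)) ^ 4)) * real (card (edges (?T G p) - edges G))"
        using inner[OF ns(3) nG free p(1) _ IM(2)] lp p(2) unfolding I_def M_def \<beta>_def h_def by blast
    qed (use h blue n1 n\<kappa> cV in \<open>simp_all add: h_def\<close>)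
    \<comment> \<open>Surjectivity is recovered afterwards from the linear size of the
      parts.\<close>
    moreover have "p ` verts G = {..<k}"
    proof (rule equalityI[OF p(1)], rule subsetI)
      fix i assume "i \<in> {..<k}"
      then have "\<delta> * real n \<le> real (card {x \<in> verts G. p x = i})" using lp by simp
      moreover have "\<delta> * real n > 0" using \<delta> n1 by simp
      ultimately have "card {x \<in> verts G. p x = i} \<noteq> 0" by linarith
      then have "{x \<in> verts G. p x = i} \<noteq> {}" by (metis card.empty)
      then show "i \<in> p ` verts G" by blast
    qed
    ultimately show ?thesis by blast
  qed
  show ?thesis
  proof (rule that[of n\<^sub>0], unfold k_def[symmetric])
    fix n and G :: "nat ugraph" and c
    assume n: "n \<ge> n\<^sub>0" and nG: "nvertex_graph n G" and free: "free_of F G"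
      and ext: "ex n H F \<le> num_copies_col H (complete_graph 2) G c"
    have G: "finite_simple_graph G" using nG by (simp add: nvertex_graph_def)
    show "\<exists>p. p ` verts G = {..<k} \<and>
      num_copies_col H (complete_graph 2) G c \<le> num_copies H (?T G p)"
    proof (cases "h \<ge> 3")
      case True
      then show ?thesis using goal[OF n nG free ext] by blast
    next
      case False
      then have "card (verts H) = 2" using h by (simp add: h_def)
      then have "num_copies_col H (complete_graph 2) G c =
          num_copies_col H (complete_graph 2) G (\<lambda>_. Red)"
        using num_copies_col_single_edge[OF H _ edgesH G] num_copies_color_all_red[OF G] by simp
      then show ?thesis using goal[OF n nG free, of "\<lambda>_. Red"] ext by simp
    qed
  qed
qed

text \<open>\<open>F\<close> is one edge with isolated vertices here, so any edge of
  \<open>G\<close> with enough further vertices would complete a copy. The embedding lemma applies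
  with one part and no cross pairs.\<close>

lemma free_col_le_edgeless:
  fixes G :: "nat ugraph"
  assumes k: "chromatic_number F = 2" and n: "2 * card (verts F) ^ 2 + 4 \<le> n"
    and nG: "nvertex_graph n G" and free: "free_of F G"
  shows "num_copies_col H (complete_graph 2) G c = num_copies H (partite_graph (verts G) (\<lambda>_. 0))"
proof -
  let ?T = "partite_graph (verts G) (\<lambda>_. 0)"
  have G: "finite_simple_graph G" and cV: "card (verts G) = n" using nG by (auto simp: nvertex_graph_def)
  have finV: "finite (verts G)" using G by (simp add: finite_simple_graph_def)
  have T: "edges ?T = {}" by (auto simp: partite_graph_def)
  have "edges G = {}"
  proof (rule ccontr)
    assume "edges G \<noteq> {}"
    then obtain x y where xy: "{x, y} \<in> edges G" using edgeE[OF G] by (metis all_not_in_conv)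
    have "\<not> free_of F G"
    proof (rule color_critical_not_free_edge[OF F crit G xy refl refl])
      have "n - 2 \<le> card (verts G - {x, y})"
        using diff_card_le_card_Diff[of "{x, y}" "verts G"] cV card_insert_le_m1[of 2 "{y}" x]
        by (cases "x = y") auto
      then show "n - 2 \<le> card ({z \<in> verts G. 0 = (0::nat)} - {x, y})" by simp
      \<comment> \<open>The summand 4 in the bound on \<open>n\<close> is what makes (n - 4) n \<le>
        (n - 2)^2 usable.\<close>
      have "2 * card (verts F) ^ 2 * n \<le> (n - 4) * n" using n by (intro mult_le_mono1) simp
      also have "\<dots> \<le> (n - 2) ^ 2"
      proof -
        obtain r where "n = r + 4" using n by (metis add_leD2 le_add_diff_inverse2)
        moreover from this have "n - 4 = r" "n - 2 = r + 2" by simp_all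
        ultimately show ?thesis by (simp add: power2_eq_square algebra_simps)
      qed
      finally show "2 * card (verts F) ^ 2 * (2 * card (edges ?T - edges G) + card (verts G)) \<le> (n - 2) ^ 2"
        by (simp add: T cV)
    qed (use k n in auto)
    then show False using free by simp
  qed
  then have "num_copies_col H (complete_graph 2) G c = num_copies H G"
    by (simp add: num_copies_col_eq[OF G] color_subgraph_def) (metis prod.collapse)
  moreover have "G = ?T" using \<open>edges G = {}\<close> T by (simp add: prod_eq_iff)
  ultimately show ?thesis by (metis arg_cong)
qed

text \<open>The bipartite graphs used against stability are guaranteed to be \<open>F\<close>-free
  only for \<chi>(F) > 2. As \<open>F\<close> has an edge, \<chi>(F) = 2 is the only other case, and
  there \<open>T\<close> has a single part.\<close>

lemma extremal_col_le_partite: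
  obtains n\<^sub>0 where "\<And>n (G :: nat ugraph) c. n \<ge> n\<^sub>0 \<Longrightarrow> nvertex_graph n G \<Longrightarrow> free_of F G \<Longrightarrow>
     ex n H F \<le> num_copies_col H (complete_graph 2) G c \<Longrightarrow>
     \<exists>p. p ` verts G = {..<chromatic_number F - 1} \<and>
       num_copies_col H (complete_graph 2) G c \<le> num_copies H (partite_graph (verts G) p)"
proof (cases "2 < chromatic_number F")
  case True
  then show ?thesis using near_extremal_col_le_partite that by blast
next
  case False
  have "chromatic_number F \<ge> 2"
  proof (rule ccontr)
    assume "\<not> chromatic_number F \<ge> 2"
    then have col: "colorable 1 F" using colorable_mono[OF colorable_chromatic_number[OF F]] by simp
    obtain u v where "{u, v} \<in> edges F" "u \<in> verts F" "v \<in> verts F"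
      using color_critical_edges_nonempty[OF crit] edgeE[OF F] by (metis all_not_in_conv)
    moreover from col obtain c :: "'b \<Rightarrow> nat" where
      "c ` verts F \<subseteq> {..<1}" "\<And>a b. {a, b} \<in> edges F \<Longrightarrow> c a \<noteq> c b"
      unfolding colorable_def by blast
    ultimately show False by (metis image_subset_iff lessThan_iff less_one)
  qed
  then have k: "chromatic_number F = 2" using False by simp
  show ?thesis
  proof (rule that[of "2 * card (verts F) ^ 2 + 4"])
    fix n and G :: "nat ugraph" and c
    assume n: "n \<ge> 2 * card (verts F) ^ 2 + 4" and G: "nvertex_graph n G" "free_of F G"
    have "verts G \<noteq> {}" using n G(1) by (auto simp: nvertex_graph_def)
    then have "(\<lambda>_. 0) ` verts G = {..<chromatic_number F - 1}" using k by auto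
    then show "\<exists>p. p ` verts G = {..<chromatic_number F - 1} \<and>
       num_copies_col H (complete_graph 2) G c \<le> num_copies H (partite_graph (verts G) p)"
      using free_col_le_edgeless[OF k n G] by (intro exI[of _ "\<lambda>_. 0"]) auto
  qed
qed

end

theorem theorem3p1:
  fixes H :: "'a ugraph" and F :: "'b ugraph"
  assumes "finite_simple_graph H" and "finite_simple_graph F"
    and "chromatic_number H < chromatic_number F"
    and "weakly_Turan_stable F H"
    and "\<exists>e. color_critical_edge F e"
  shows "\<exists>n\<^sub>0. \<forall>n\<ge>n\<^sub>0. \<exists>T :: nat ugraph.
           complete_multipartite (chromatic_number F - 1) T \<and> nvertex_graph n T \<and>
           rb n H F = ex n H F \<and>
           ex n H F = ex_col n H (complete_graph 2) F \<and>
           ex_col n H (complete_graph 2) F = num_copies H T"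
proof -
  note H = assms(1) and F = assms(2)
  obtain e where crit: "color_critical_edge F e" using assms(5) by blast
  have edgesF: "edges F \<noteq> {}" by (rule color_critical_edges_nonempty[OF crit])
  obtain n\<^sub>0 where upper: "\<And>n (G :: nat ugraph) c. n \<ge> n\<^sub>0 \<Longrightarrow> nvertex_graph n G \<Longrightarrow> free_of F G \<Longrightarrow>
     ex n H F \<le> num_copies_col H (complete_graph 2) G c \<Longrightarrow>
     \<exists>p. p ` verts G = {..<chromatic_number F - 1} \<and>
       num_copies_col H (complete_graph 2) G c \<le> num_copies H (partite_graph (verts G) p)"
    using extremal_col_le_partite[OF assms(1-4) crit] by blast
  show ?thesis
  proof (intro exI[of _ n\<^sub>0] allI impI)
    fix n assume n: "n \<ge> n\<^sub>0"
    obtain G :: "nat ugraph" and c where G: "nvertex_graph n G" "free_of F G"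
      "ex_col n H (complete_graph 2) F = num_copies_col H (complete_graph 2) G c"
      using ex_col_attained[OF H F edgesF] .
    \<comment> \<open>The chain also supplies the hypothesis of \<open>upper\<close>: a coloured
      extremal graph counts at least \<open>ex n H F\<close>.\<close>
    note chain = ex_le_rb[OF H F edgesF, of n] rb_le_ex_col[OF H F edgesF, of n]
    obtain p where p: "p ` verts G = {..<chromatic_number F - 1}"
      "num_copies_col H (complete_graph 2) G c \<le> num_copies H (partite_graph (verts G) p)"
      using upper[OF n G(1,2), of c] order_trans[OF chain] unfolding G(3) by blast
    define T where "T = partite_graph (verts G) p"
    have finV: "finite (verts G)" "card (verts G) = n"
      using G(1) by (auto simp: nvertex_graph_def finite_simple_graph_def)
    have T: "complete_multipartite (chromatic_number F - 1) T" "nvertex_graph n T"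
      using complete_multipartite_partite_graph[OF finV(1) p(1)] finite_simple_partite_graph[OF finV(1)] finV(2)
      by (auto simp: T_def nvertex_graph_def)
    \<comment> \<open>\<open>T\<close> is itself \<open>F\<close>-free, so its count is at most
      \<open>ex n H F\<close> and all inequalities become equalities.\<close>
    have "colorable (chromatic_number F - 1) T"
      unfolding T_def using p(1) by (intro colorable_partite_graph) simp
    from colorable_free_of[OF F this] have "free_of F T" using assms(3) by simp
    then have "num_copies H T \<le> ex n H F" using num_copies_le_ex[OF H F edgesF T(2)] by simp
    then show "\<exists>T :: nat ugraph.
           complete_multipartite (chromatic_number F - 1) T \<and> nvertex_graph n T \<and>
           rb n H F = ex n H F \<and>
           ex n H F = ex_col n H (complete_graph 2) F \<and>
           ex_col n H (complete_graph 2) F = num_copies H T"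
      using T chain p(2) G(3) by (intro exI[of _ T]) (auto simp: T_def)
  qed
qed

end
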